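(* Let $(\phi_t)_{t\ge0}$ be a semigroup of holomorphic self-maps of $\mathbb{D}$ that is not a group, and let $\Delta$ be a petal of $(\phi_t)$ with tangential speed $v^T_\Delta(t)=d_{\mathbb{D}}(\phi_t(z),\eta)$, $t\le 0$ (where $z\in\Delta$ and $\eta$ is the geodesic associated with $z$ and $\Delta$). Then the following are true. (i) If $\Delta$ is hyperbolic, then $\limsup_{t\to-\infty}v^T_\Delta(t)<+\infty$. (ii) If $\Delta$ is parabolic, then $\lim_{t\to-\infty}v^T_\Delta(t)=+\infty$.
   Context: $\mathbb{D}$ is the unit disk, and $d_{\mathbb{D}}(z,w)=\operatorname{arctanh}\left|\frac{z-w}{1-\bar z w}\right|$ is its hyperbolic distance. A semigroup in $\mathbb{D}$ is a family $(\phi_t)_{t\ge0}$ of holomorphic self-maps of $\mathbb{D}$ with $\phi_0=\mathrm{id}$, $\phi_{t+s}=\phi_t\circ\phi_s$ for all $t,s\ge0$, and $\phi_t(z)\to z$ uniformly on compacta as $t\to0^+$. It is a group if some (equivalently every) $\phi_{t_0}$, $t_0>0$, is an automorphism of $\mathbb{D}$. If it is not a group, there is a unique $\tau\in\overline{\mathbb{D}}$ (the Denjoy--Wolff point) with $\phi_t(z)\to\tau$ as $t\to+\infty$ for all $z\in\mathbb{D}$; the semigroup is elliptic if $\tau\in\mathbb{D}$ and non-elliptic if $\tau\in\partial\mathbb{D}$. A boundary fixed point is a point $\sigma\in\partial\mathbb{D}$ with $\angle\lim_{z\to\sigma}\phi_t(z)=\sigma$ for all $t\ge0$; it is regular if the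 angular derivative $\phi_t'(\sigma)$ is finite for all $t\ge0$. A repelling fixed point is a regular boundary fixed point different from $\tau$. The backward invariant set is $\mathcal{W}=\bigcap_{t\ge0}\phi_t(\mathbb{D})$. A petal is a non-empty connected component $\Delta$ of the interior of $\mathcal{W}$. Each $\phi_t$ ($t\ge 0$) restricts to an automorphism of $\Delta$; for $z\in\Delta$ and $t\le0$ one writes $\phi_t(z):=(\phi_{-t}|_\Delta)^{-1}(z)$. The curve $t\mapsto\phi_t(z)$, $t\le0$, is the backward orbit of $z$. A non-elliptic semigroup has a unique Koenigs function: a univalent holomorphic $h:\mathbb{D}\to\mathbb{C}$ with $h(0)=0$ and $h(\phi_t(z))=h(z)+t$ for all $z\in\mathbb D$, $t\ge0$. A petal $\Delta$ of a non-elliptic semigroup is hyperbolic if $h(\Delta)$ is a maximal horizontal strip in $h(\mathbb{D})$, and parabolic if $h(\Delta)$ is a maximal horizontal half-plane in $h(\mathbb{D})$ (one of the two always holds). Every petal of an elliptic semigroup is called hyperbolic. All backward orbits in a hyperbolic petal converge, as $t\to-\infty$, to one and the same repelling fixed point $\sigma$; all backward orbits in a parabolic petal converge to $\tau$. Given $z\in\Delta$, $\eta:(-1,1)\to\mathbb{D}$ denotes the (full) geodesic of $d_{\mathbb{D}}$ with $\eta(0)=z$ and $\lim_{r\to1^-}\eta(r)=\sigma$ if $\Delta$ is hyperbolic, respectively $\lim_{r\to1^-}\eta(r)=\tau$ if $\Delta$ is parabolic. For $w\in\mathbb{D}$, $d_{\mathbb{D}}(w,\eta):=\inf_{r\in(-1,1)}d_{\mathbb{D}}(w,\eta(r))$.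 *)

theory Defs
  imports "HOL-Complex_Analysis.Complex_Analysis"
begin

abbreviation unit_disk :: "complex set" where
  "unit_disk \<equiv> ball 0 1"

definition hyp_dist :: "complex \<Rightarrow> complex \<Rightarrow> real" where
  "hyp_dist z w = artanh (cmod ((z - w) / (1 - cnj z * w)))"


section \<open>Semigroups in the unit disk\<close>

text \<open>Semigroups are families indexed by all reals, of which only the parameters
  \<open>t \<ge> 0\<close> and the values on the disk are constrained or used.\<close>

definition disk_semigroup :: "(real \<Rightarrow> complex \<Rightarrow> complex) \<Rightarrow> bool" where
  "disk_semigroup \<phi> \<longleftrightarrow>
     (\<forall>t\<ge>0. \<phi> t holomorphic_on unit_disk \<and> \<phi> t ` unit_disk \<subseteq> unit_disk) \<and>
     (\<forall>z\<in>unit_disk. \<phi> 0 z = z) \<and>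
     (\<forall>t\<ge>0. \<forall>s\<ge>0. \<forall>z\<in>unit_disk. \<phi> (t + s) z = \<phi> t (\<phi> s z)) \<and>
     (\<forall>K. compact K \<and> K \<subseteq> unit_disk \<longrightarrow> uniform_limit K \<phi> (\<lambda>z. z) (at_right 0))"

definition disk_automorphism :: "(complex \<Rightarrow> complex) \<Rightarrow> bool" where
  "disk_automorphism f \<longleftrightarrow> f holomorphic_on unit_disk \<and> bij_betw f unit_disk unit_disk"

definition disk_group :: "(real \<Rightarrow> complex \<Rightarrow> complex) \<Rightarrow> bool" where
  "disk_group \<phi> \<longleftrightarrow> disk_semigroup \<phi> \<and> (\<exists>t>0. disk_automorphism (\<phi> t))"

text \<open>The next three notions are meant for semigroups that are not groups; the point
  is then unique, being a limit.\<close>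

definition Denjoy_Wolff_point :: "(real \<Rightarrow> complex \<Rightarrow> complex) \<Rightarrow> complex \<Rightarrow> bool" where
  "Denjoy_Wolff_point \<phi> \<tau> \<longleftrightarrow>
     \<tau> \<in> cball 0 1 \<and> (\<forall>z\<in>unit_disk. ((\<lambda>t. \<phi> t z) \<longlongrightarrow> \<tau>) at_top)"

definition elliptic :: "(real \<Rightarrow> complex \<Rightarrow> complex) \<Rightarrow> bool" where
  "elliptic \<phi> \<longleftrightarrow> (\<exists>\<tau>\<in>unit_disk. Denjoy_Wolff_point \<phi> \<tau>)"

definition non_elliptic :: "(real \<Rightarrow> complex \<Rightarrow> complex) \<Rightarrow> bool" where
  "non_elliptic \<phi> \<longleftrightarrow> (\<exists>\<tau>\<in>sphere 0 1. Denjoy_Wolff_point \<phi> \<tau>)"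


section \<open>Boundary fixed points\<close>

definition Stolz_region :: "complex \<Rightarrow> real \<Rightarrow> complex set" where
  "Stolz_region \<sigma> R = {z \<in> unit_disk. cmod (\<sigma> - z) < R * (1 - cmod z)}"

definition has_angular_limit :: "(complex \<Rightarrow> complex) \<Rightarrow> complex \<Rightarrow> complex \<Rightarrow> bool" where
  "has_angular_limit f \<sigma> L \<longleftrightarrow> (\<forall>R>1. (f \<longlongrightarrow> L) (at \<sigma> within Stolz_region \<sigma> R))"

text \<open>Here \<open>p\<close> is the angular limit of \<open>f\<close> at \<open>\<sigma>\<close>, and \<open>c\<close> the (finite) angular derivative.\<close>

definition has_angular_derivative ::
    "(complex \<Rightarrow> complex) \<Rightarrow> complex \<Rightarrow> complex \<Rightarrow> complex \<Rightarrow> bool" where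
  "has_angular_derivative f \<sigma> p c \<longleftrightarrow>
     has_angular_limit f \<sigma> p \<and> has_angular_limit (\<lambda>z. (f z - p) / (z - \<sigma>)) \<sigma> c"

definition boundary_fixed_point :: "(real \<Rightarrow> complex \<Rightarrow> complex) \<Rightarrow> complex \<Rightarrow> bool" where
  "boundary_fixed_point \<phi> \<sigma> \<longleftrightarrow>
     \<sigma> \<in> sphere 0 1 \<and> (\<forall>t\<ge>0. has_angular_limit (\<phi> t) \<sigma> \<sigma>)"

definition regular_fixed_point :: "(real \<Rightarrow> complex \<Rightarrow> complex) \<Rightarrow> complex \<Rightarrow> bool" where
  "regular_fixed_point \<phi> \<sigma> \<longleftrightarrow>
     boundary_fixed_point \<phi> \<sigma> \<and> (\<forall>t\<ge>0. \<exists>c. has_angular_derivative (\<phi> t) \<sigma> \<sigma> c)"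

definition repelling_fixed_point :: "(real \<Rightarrow> complex \<Rightarrow> complex) \<Rightarrow> complex \<Rightarrow> bool" where
  "repelling_fixed_point \<phi> \<sigma> \<longleftrightarrow> regular_fixed_point \<phi> \<sigma> \<and> \<not> Denjoy_Wolff_point \<phi> \<sigma>"


section \<open>Petals\<close>

definition backward_invariant_set :: "(real \<Rightarrow> complex \<Rightarrow> complex) \<Rightarrow> complex set" where
  "backward_invariant_set \<phi> = (\<Inter>t\<in>{0..}. \<phi> t ` unit_disk)"

definition petal :: "(real \<Rightarrow> complex \<Rightarrow> complex) \<Rightarrow> complex set \<Rightarrow> bool" where
  "petal \<phi> \<Delta> \<longleftrightarrow> \<Delta> \<in> components (interior (backward_invariant_set \<phi>))"

text \<open>The point denoted \<open>\<phi>\<^sub>t(z)\<close> for \<open>t \<le> 0\<close> and \<open>z \<in> \<Delta>\<close>.\<close>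

definition backward_orbit ::
    "(real \<Rightarrow> complex \<Rightarrow> complex) \<Rightarrow> complex set \<Rightarrow> complex \<Rightarrow> real \<Rightarrow> complex" where
  "backward_orbit \<phi> \<Delta> z t = inv_into \<Delta> (\<phi> (- t)) z"

definition Koenigs_function ::
    "(real \<Rightarrow> complex \<Rightarrow> complex) \<Rightarrow> (complex \<Rightarrow> complex) \<Rightarrow> bool" where
  "Koenigs_function \<phi> h \<longleftrightarrow>
     h holomorphic_on unit_disk \<and> inj_on h unit_disk \<and> h 0 = 0 \<and>
     (\<forall>z\<in>unit_disk. \<forall>t\<ge>0. h (\<phi> t z) = h z + of_real t)"

definition horizontal_strip :: "complex set \<Rightarrow> bool" where
  "horizontal_strip S \<longleftrightarrow> (\<exists>a b. a < b \<and> S = {w. a < Im w \<and> Im w < b})"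

definition horizontal_half_plane :: "complex set \<Rightarrow> bool" where
  "horizontal_half_plane S \<longleftrightarrow> (\<exists>a. S = {w. a < Im w} \<or> S = {w. Im w < a})"

definition maximal_subset :: "(complex set \<Rightarrow> bool) \<Rightarrow> complex set \<Rightarrow> complex set \<Rightarrow> bool" where
  "maximal_subset P S \<Omega> \<longleftrightarrow>
     P S \<and> S \<subseteq> \<Omega> \<and> (\<forall>S'. P S' \<and> S \<subseteq> S' \<and> S' \<subseteq> \<Omega> \<longrightarrow> S' = S)"

definition hyperbolic_petal :: "(real \<Rightarrow> complex \<Rightarrow> complex) \<Rightarrow> complex set \<Rightarrow> bool" where
  "hyperbolic_petal \<phi> \<Delta> \<longleftrightarrow> petal \<phi> \<Delta> \<and>
     (elliptic \<phi> \<or>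
      non_elliptic \<phi> \<and>
        (\<exists>h. Koenigs_function \<phi> h \<and>
             maximal_subset horizontal_strip (h ` \<Delta>) (h ` unit_disk)))"

definition parabolic_petal :: "(real \<Rightarrow> complex \<Rightarrow> complex) \<Rightarrow> complex set \<Rightarrow> bool" where
  "parabolic_petal \<phi> \<Delta> \<longleftrightarrow> petal \<phi> \<Delta> \<and> non_elliptic \<phi> \<and>
     (\<exists>h. Koenigs_function \<phi> h \<and>
          maximal_subset horizontal_half_plane (h ` \<Delta>) (h ` unit_disk))"


section \<open>Geodesics and tangential speed\<close>

text \<open>A full geodesic is a distance-minimising curve whose two ends leave every compact
  subset of the disk. No particular parametrisation of the image is imposed: minimality is
  additivity of the distance along the curve.\<close>

definition full_geodesic :: "(real \<Rightarrow> complex) \<Rightarrow> bool" where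
  "full_geodesic \<eta> \<longleftrightarrow>
     continuous_on {-1<..<1} \<eta> \<and> inj_on \<eta> {-1<..<1} \<and> \<eta> ` {-1<..<1} \<subseteq> unit_disk \<and>
     (\<forall>r s u. -1 < r \<and> r \<le> s \<and> s \<le> u \<and> u < 1 \<longrightarrow>
        hyp_dist (\<eta> r) (\<eta> u) = hyp_dist (\<eta> r) (\<eta> s) + hyp_dist (\<eta> s) (\<eta> u)) \<and>
     ((\<lambda>r. cmod (\<eta> r)) \<longlongrightarrow> 1) (at_left 1) \<and>
     ((\<lambda>r. cmod (\<eta> r)) \<longlongrightarrow> 1) (at_right (-1))"

text \<open>The boundary point at which the geodesics associated with a petal end.\<close>

definition petal_endpoint :: "(real \<Rightarrow> complex \<Rightarrow> complex) \<Rightarrow> complex set \<Rightarrow> complex \<Rightarrow> bool" where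
  "petal_endpoint \<phi> \<Delta> p \<longleftrightarrow>
     hyperbolic_petal \<phi> \<Delta> \<and> repelling_fixed_point \<phi> p \<and>
       (\<forall>w\<in>\<Delta>. (backward_orbit \<phi> \<Delta> w \<longlongrightarrow> p) at_bot) \<or>
     parabolic_petal \<phi> \<Delta> \<and> Denjoy_Wolff_point \<phi> p"

definition petal_geodesic ::
    "(real \<Rightarrow> complex \<Rightarrow> complex) \<Rightarrow> complex set \<Rightarrow> complex \<Rightarrow> (real \<Rightarrow> complex) \<Rightarrow> bool" where
  "petal_geodesic \<phi> \<Delta> z \<eta> \<longleftrightarrow>
     full_geodesic \<eta> \<and> \<eta> 0 = z \<and> (\<exists>p. petal_endpoint \<phi> \<Delta> p \<and> (\<eta> \<longlongrightarrow> p) (at_left 1))"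

definition hyp_dist_curve :: "complex \<Rightarrow> (real \<Rightarrow> complex) \<Rightarrow> real" where
  "hyp_dist_curve w \<eta> = (INF r\<in>{-1<..<1}. hyp_dist w (\<eta> r))"

definition tangential_speed ::
    "(real \<Rightarrow> complex \<Rightarrow> complex) \<Rightarrow> complex set \<Rightarrow> complex \<Rightarrow> (real \<Rightarrow> complex) \<Rightarrow> real \<Rightarrow> real" where
  "tangential_speed \<phi> \<Delta> z \<eta> t = hyp_dist_curve (backward_orbit \<phi> \<Delta> z t) \<eta>"

end

theory Submission imports Defs begin

text \<open>
  All estimates are made with \<open>S(a,b) = (1 - |a|\<^sup>2) (1 - |b|\<^sup>2) / |1 - cnj a b|\<^sup>2\<close>, which is
  \<open>sech\<^sup>2\<close> of the hyperbolic distance of \<open>a\<close> and \<open>b\<close>. Holomorphic self-maps of the disk do not decrease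
  \<open>S\<close> (lemma \<open>Schwarz_Pick\<close>), a bounded distance means that \<open>S\<close> stays away from 0, and a distance
  tending to infinity means that \<open>S\<close> tends to 0. After moving \<open>z = \<eta> 0\<close> to the origin by a Moebius map, the
  geodesic \<open>\<eta>\<close> becomes the diameter ending at the image of its endpoint \<open>p\<close>
  (lemma \<open>full_geodesic_normalized\<close>), so that distances to \<open>\<eta>\<close> can be computed.

  Hyperbolic petals. Here \<open>p\<close> is the limit of the backward orbit, and the point is that this limit is
  non-tangential: \<open>|p - w| \<le> K (1 - |w|\<^sup>2)\<close> along the orbit. A point with this property is at bounded
  distance from \<open>\<eta>\<close> (lemma \<open>hyp_dist_curve_le\<close>). Let \<open>w n\<close> be the backward orbit at time \<open>-n\<close>. Since the
  inverse flow maps the petal holomorphically into the disk, the hyperbolic distances of successive points are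
  bounded, whence \<open>|w n - w (n+1)| \<le> C (1 - |w (n+1)|\<^sup>2)\<close>. Moreover \<open>1 - |w n|\<^sup>2\<close> decays at least
  geometrically (lemma \<open>backward_sequence_ratio\<close>): otherwise Julia's lemma, applied along \<open>w n\<close>,
  would make every horodisk at \<open>p\<close> invariant under \<open>\<phi> 1\<close>, and then forward orbits could only converge to
  \<open>p\<close>, which is not the Denjoy-Wolff point. The steps therefore sum to a multiple of \<open>1 - |w n|\<^sup>2\<close>.

  Parabolic petals. Here \<open>p = \<tau>\<close> is the Denjoy-Wolff point, and its horodisks are invariant under the forward
  flow (lemma \<open>Wolff_horocycle\<close>). Hence the backward orbit never enters the horodisk at \<open>\<tau>\<close> through
  \<open>z\<close>, and if it converges to \<open>\<tau>\<close> it does so tangentially, which forces its distance to \<open>\<eta>\<close> to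
  infinity (lemma \<open>hyp_dist_curve_at_top\<close>). It remains to see that the backward orbit does converge to
  \<open>\<tau>\<close> (lemma \<open>parabolic_backward_orbit_tendsto\<close>). In the Koenigs coordinate the petal is a half-plane
  \<open>H\<close> and the orbit of \<open>z\<close> is \<open>h z - R\<close>. It is compared with the point reached from \<open>h z\<close> by moving \<open>R\<close> into
  \<open>H\<close> and then \<open>R\<close> to the right. Schwarz-Pick for \<open>\<phi> R\<close> shows that this auxiliary point tends to \<open>\<tau>\<close>.
  The hyperbolic metric of \<open>H\<close> gives \<open>S \<ge> const / R\<close> for it and \<open>h z - R\<close>. On the other hand the image
  of \<open>h\<close> lies in a plane slit along a half-line to the left, and comparison with the slit plane gives
  \<open>1 - |w|\<^sup>2 = O(R powr (-3/2))\<close> for the point \<open>w\<close> over \<open>h z - R\<close>. Both together force the Euclidean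
  distance of the two points to 0.

  The two kinds of petal exclude each other, because on a half-plane any two Koenigs coordinates differ by
  a translation (lemma \<open>strip_half_plane_exclusive\<close>).
\<close>

section \<open>The hyperbolic distance and the Schwarz-Pick lemma\<close>

text \<open>The value \<open>1 - \<rho>\<^sup>2 = sech\<^sup>2 d\<close>, where \<open>\<rho>\<close> is the pseudo-hyperbolic and \<open>d\<close> the hyperbolic
  distance. As a quotient of products it is easier to estimate than either distance.\<close>

definition sech2 :: "complex \<Rightarrow> complex \<Rightarrow> real" where
  "sech2 a b = (1 - (cmod a)\<^sup>2) * (1 - (cmod b)\<^sup>2) / (cmod (1 - cnj a * b))\<^sup>2"

text \<open>The identity behind everything that follows: it shows that \<open>S\<close> and the squared pseudo-hyperbolic distance add up to 1,
  and that \<open>|a - b| \<le> |1 - cnj a b|\<close> in the closed disk, with equality when \<open>a\<close> or \<open>b\<close> lies on the unit circle.\<close>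

lemma norm_one_minus_cnj_mult:
  "(cmod (1 - cnj a * b))\<^sup>2 = (cmod (a - b))\<^sup>2 + (1 - (cmod a)\<^sup>2) * (1 - (cmod b)\<^sup>2)"
  by (simp add: cmod_power2) (simp add: power2_eq_square algebra_simps)

lemma norm_one_minus_cnj_commute: "cmod (1 - cnj a * b) = cmod (1 - cnj b * a)"
proof -
  have "1 - cnj a * b = cnj (1 - cnj b * a)"
    by simp
  then show ?thesis
    by (metis complex_mod_cnj)
qed

lemma sech2_commute: "sech2 a b = sech2 b a"
  unfolding sech2_def norm_one_minus_cnj_commute[of a b]
  by (simp only: mult.commute[of "1 - (cmod a)\<^sup>2"])

lemma one_minus_norm_le:
  assumes "cmod b \<le> 1"
  shows "1 - cmod a \<le> cmod (1 - cnj a * b)"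
proof -
  have "cmod (cnj a * b) \<le> cmod a"
    using assms by (simp add: norm_mult mult_left_le)
  then show ?thesis
    using norm_triangle_ineq2[of 1 "cnj a * b"] by simp
qed

lemma one_minus_norm_le':
  assumes "cmod a \<le> 1"
  shows "1 - cmod b \<le> cmod (1 - cnj a * b)"
proof -
  have "cmod (cnj a * b) \<le> cmod b"
    using assms by (simp add: norm_mult mult_left_le_one_le)
  then show ?thesis
    using norm_triangle_ineq2[of 1 "cnj a * b"] by simp
qed

lemma one_minus_cnj_mult_pos:
  assumes "cmod a < 1" "cmod b \<le> 1"
  shows "0 < cmod (1 - cnj a * b)"
  using one_minus_norm_le[OF assms(2), of a] assms by linarith

lemma norm_one_minus_cnj_le_2:
  assumes "cmod a \<le> 1" "cmod b \<le> 1"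
  shows "cmod (1 - cnj a * b) \<le> 2"
proof -
  have "cmod (1 - cnj a * b) \<le> 1 + cmod (cnj a * b)"
    using norm_triangle_ineq4[of 1 "cnj a * b"] by simp
  also have "cmod (cnj a * b) \<le> 1"
    using assms by (simp add: norm_mult mult_le_one)
  finally show ?thesis by simp
qed

lemma one_minus_power2_pos: "cmod a < 1 \<Longrightarrow> 0 < 1 - (cmod a)\<^sup>2"
  by (simp add: abs_square_less_1)

lemma one_minus_power2_le:
  assumes "x \<le> (1::real)" "0 \<le> x"
  shows "1 - x \<le> 1 - x\<^sup>2" "1 - x\<^sup>2 \<le> 2 * (1 - x)"
proof -
  have "x * x \<le> x * 1" 
    using assms by (intro mult_left_mono) auto
  then show "1 - x \<le> 1 - x\<^sup>2"
    by (simp add: power2_eq_square)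
  have "0 \<le> (1 - x)\<^sup>2" by simp
  then show "1 - x\<^sup>2 \<le> 2 * (1 - x)"
    unfolding power2_diff by (simp add: algebra_simps)
qed

lemma sech2_pos: "cmod a < 1 \<Longrightarrow> cmod b < 1 \<Longrightarrow> 0 < sech2 a b"
  using one_minus_cnj_mult_pos[of a b] one_minus_power2_pos[of a] one_minus_power2_pos[of b]
  by (simp add: sech2_def)

lemma pseudo_hyperbolic_eq_sech2:
  assumes "cmod a < 1" "cmod b < 1"
  shows "(cmod ((a - b) / (1 - cnj a * b)))\<^sup>2 = 1 - sech2 a b"
proof -
  have "(cmod (1 - cnj a * b))\<^sup>2 \<noteq> 0"
    using one_minus_cnj_mult_pos[of a b] assms by auto
  moreover have "(cmod (a - b))\<^sup>2 = (cmod (1 - cnj a * b))\<^sup>2 - (1 - (cmod a)\<^sup>2) * (1 - (cmod b)\<^sup>2)"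
    using norm_one_minus_cnj_mult[of a b] by simp
  ultimately show ?thesis
    unfolding sech2_def norm_divide power_divide by (simp add: diff_divide_distrib)
qed

lemma sech2_le_1: "cmod a < 1 \<Longrightarrow> cmod b < 1 \<Longrightarrow> sech2 a b \<le> 1"
  using pseudo_hyperbolic_eq_sech2[of a b] by (smt (verit) zero_le_power2)

lemma sech2_ge_defect:
  assumes "cmod a < 1" "cmod b < 1"
  shows "(1 - (cmod a)\<^sup>2) * (1 - (cmod b)\<^sup>2) / 4 \<le> sech2 a b"
proof -
  have "0 < cmod (1 - cnj a * b)"
    using one_minus_cnj_mult_pos assms by auto
  moreover have "(cmod (1 - cnj a * b))\<^sup>2 \<le> 2\<^sup>2"
    using norm_one_minus_cnj_le_2[of a b] assms by (intro power_mono) auto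
  ultimately show ?thesis
    unfolding sech2_def using one_minus_power2_pos[OF assms(1)] one_minus_power2_pos[OF assms(2)]
    by (intro frac_le) auto
qed

lemma dist_le_of_sech2:
  assumes "cmod a < 1" "cmod b < 1"
  shows "(cmod (a - b))\<^sup>2 \<le> 4 * (1 - sech2 a b)"
proof -
  have d: "0 < cmod (1 - cnj a * b)"
    using one_minus_cnj_mult_pos[of a b] assms by auto
  have "(cmod (1 - cnj a * b))\<^sup>2 \<le> 2\<^sup>2"
    using norm_one_minus_cnj_le_2[of a b] assms by (intro power_mono) auto
  moreover have "(cmod (a - b))\<^sup>2 = (cmod (1 - cnj a * b))\<^sup>2 * (1 - sech2 a b)"
    using d by (simp add: pseudo_hyperbolic_eq_sech2[OF assms, symmetric] norm_divide power_divide)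
  moreover have "0 \<le> 1 - sech2 a b"
    using sech2_le_1[OF assms] by simp
  ultimately show ?thesis
    using mult_right_mono[of "(cmod (1 - cnj a * b))\<^sup>2" "2\<^sup>2" "1 - sech2 a b"] by simp
qed

text \<open>Points at bounded hyperbolic distance have comparable distances to the unit circle, and their Euclidean distance
  is of the same order. All three bounds follow from \<open>1 - |b|\<^sup>2 \<le> 2 |1 - cnj a b|\<close>.\<close>

lemma sech2_compare:
  assumes "cmod a < 1" "cmod b < 1" "0 < k" "k \<le> sech2 a b"
  shows "cmod (1 - cnj a * b) \<le> 2 / k * (1 - (cmod a)\<^sup>2)"
    and "1 - (cmod b)\<^sup>2 \<le> 4 / k * (1 - (cmod a)\<^sup>2)"
    and "cmod (a - b) \<le> 2 / k * (1 - (cmod a)\<^sup>2)"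
proof -
  let ?d = "cmod (1 - cnj a * b)"
  have d: "0 < ?d"
    using one_minus_cnj_mult_pos assms by auto
  have b: "1 - (cmod b)\<^sup>2 \<le> 2 * ?d"
    using one_minus_power2_le(2)[of "cmod b"] one_minus_norm_le'[of a b] assms by auto
  have a: "0 < 1 - (cmod a)\<^sup>2" "0 < 1 - (cmod b)\<^sup>2"
    using one_minus_power2_pos assms by auto
  have "k * ?d\<^sup>2 \<le> (1 - (cmod a)\<^sup>2) * (1 - (cmod b)\<^sup>2)"
    using assms(4) d by (simp add: sech2_def pos_le_divide_eq)
  also have "\<dots> \<le> (1 - (cmod a)\<^sup>2) * (2 * ?d)"
    using a b by (intro mult_left_mono) auto
  finally have "k * ?d \<le> (1 - (cmod a)\<^sup>2) * 2"
    using d by (simp add: power2_eq_square)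
  then show 1: "?d \<le> 2 / k * (1 - (cmod a)\<^sup>2)"
    using assms(3) by (simp add: field_simps)
  have "1 - (cmod b)\<^sup>2 \<le> 2 * (2 / k * (1 - (cmod a)\<^sup>2))"
    using 1 b by linarith
  then show "1 - (cmod b)\<^sup>2 \<le> 4 / k * (1 - (cmod a)\<^sup>2)"
    by simp
  have "(cmod (a - b))\<^sup>2 \<le> ?d\<^sup>2"
    unfolding norm_one_minus_cnj_mult using a by (simp add: less_imp_le)
  then have "cmod (a - b) \<le> ?d"
    using d by (simp add: power2_le_iff_abs_le)
  then show "cmod (a - b) \<le> 2 / k * (1 - (cmod a)\<^sup>2)"
    using 1 by linarith
qed

text \<open>A substitute for the triangle inequality of the hyperbolic distance: bounded distances \<open>a\<close>-\<open>b\<close> and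
  \<open>b\<close>-\<open>c\<close> give a bounded distance \<open>a\<close>-\<open>c\<close>, since everything is comparable with \<open>1 - |b|\<^sup>2\<close>.\<close>

lemma sech2_quasi_triangle:
  assumes k: "0 < k1" "0 < (k2::real)"
  shows "\<exists>k>0. \<forall>a b c. cmod a < 1 \<longrightarrow> cmod b < 1 \<longrightarrow> cmod c < 1 \<longrightarrow>
    k1 \<le> sech2 a b \<longrightarrow> k2 \<le> sech2 b c \<longrightarrow> k \<le> sech2 a c"
proof -
  define k where "k = (k1 / 4) * (k2 / 4) / (2 / k1 + 2 / k2)\<^sup>2"
  have "0 < 2 / k1 + 2 / k2"
    using k by (simp add: add_pos_pos)
  then have "0 < k"
    using k by (simp add: k_def)
  moreover have "k \<le> sech2 a c"
    if abc: "cmod a < 1" "cmod b < 1" "cmod c < 1" and ab: "k1 \<le> sech2 a b" and bc: "k2 \<le> sech2 b c" for a b c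
  proof -
    define q where "q = 1 - (cmod b)\<^sup>2"
    have q: "0 < q"
      unfolding q_def by (rule one_minus_power2_pos[OF abc(2)])
    have cb: "k2 \<le> sech2 c b" and ba: "k1 \<le> sech2 b a"
      using ab bc by (simp_all add: sech2_commute)
    have A: "k1 / 4 * q \<le> 1 - (cmod a)\<^sup>2"
      using sech2_compare(2)[OF abc(1,2) k(1) ab] k by (simp add: q_def field_simps)
    have C: "k2 / 4 * q \<le> 1 - (cmod c)\<^sup>2"
      using sech2_compare(2)[OF abc(3,2) k(2) cb] k by (simp add: q_def field_simps)
    have "1 - cnj a * c = (1 - cnj a * b) + cnj a * (b - c)"
      by (simp add: algebra_simps)
    then have "cmod (1 - cnj a * c) \<le> cmod (1 - cnj a * b) + cmod (cnj a * (b - c))"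
      by (metis norm_triangle_ineq)
    also have "cmod (cnj a * (b - c)) \<le> cmod (b - c)"
      using abc(1) by (simp add: norm_mult mult_left_le_one_le)
    also have "cmod (b - c) \<le> 2 / k2 * q"
      unfolding q_def by (rule sech2_compare(3)[OF abc(2,3) k(2) bc])
    also have "cmod (1 - cnj a * b) \<le> 2 / k1 * q"
      using sech2_compare(1)[OF abc(2,1) k(1) ba] by (simp add: q_def norm_one_minus_cnj_commute[of a b])
    finally have d: "cmod (1 - cnj a * c) \<le> (2 / k1 + 2 / k2) * q"
      by (simp add: algebra_simps)
    have d0: "0 < cmod (1 - cnj a * c)"
      using one_minus_cnj_mult_pos abc by auto
    have "k = (k1 / 4 * q) * (k2 / 4 * q) / ((2 / k1 + 2 / k2) * q)\<^sup>2"
      using q by (simp add: k_def power_mult_distrib power2_eq_square)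
    also have "\<dots> \<le> (1 - (cmod a)\<^sup>2) * (1 - (cmod c)\<^sup>2) / (cmod (1 - cnj a * c))\<^sup>2"
      using A C d d0 q k one_minus_power2_pos[OF abc(1)] one_minus_power2_pos[OF abc(3)]
      by (intro frac_le mult_mono power_mono mult_nonneg_nonneg) auto
    finally show ?thesis
      by (simp add: sech2_def)
  qed
  ultimately show ?thesis
    by blast
qed

lemma artanh_mono:
  assumes "0 \<le> x" "x \<le> y" "y < (1::real)"
  shows "artanh x \<le> artanh y"
proof -
  have "(1 + x) / (1 - x) \<le> (1 + y) / (1 - y)"
    using assms by (intro frac_le) auto
  moreover have "0 < (1 + x) / (1 - x)"
    using assms by auto
  ultimately show ?thesis
    by (simp add: artanh_def)
qed

lemma hyp_dist_eq_sech2: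
  assumes "cmod a < 1" "cmod b < 1"
  shows "hyp_dist a b = artanh (sqrt (1 - sech2 a b))"
  unfolding hyp_dist_def pseudo_hyperbolic_eq_sech2[OF assms, symmetric] by simp

lemma hyp_dist_le:
  assumes "cmod a < 1" "cmod b < 1" "0 < k" "k \<le> sech2 a b"
  shows "hyp_dist a b \<le> artanh (sqrt (1 - k))"
  unfolding hyp_dist_eq_sech2[OF assms(1,2)]
  using sech2_le_1[OF assms(1,2)] assms by (intro artanh_mono) auto

lemma hyp_dist_ge:
  assumes "cmod a < 1" "cmod b < 1" "sech2 a b \<le> k" "k \<le> 1"
  shows "artanh (sqrt (1 - k)) \<le> hyp_dist a b"
  unfolding hyp_dist_eq_sech2[OF assms(1,2)]
  using sech2_pos[OF assms(1,2)] assms by (intro artanh_mono) auto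

lemma hyp_dist_nonneg:
  assumes "cmod a < 1" "cmod b < 1"
  shows "0 \<le> hyp_dist a b"
proof -
  define x where "x = sqrt (1 - sech2 a b)"
  have x: "0 \<le> x" "x < 1"
    using sech2_le_1[OF assms] sech2_pos[OF assms] by (auto simp: x_def)
  then have "1 \<le> (1 + x) / (1 - x)"
    by (simp add: field_simps)
  then show ?thesis
    unfolding hyp_dist_eq_sech2[OF assms] x_def[symmetric] artanh_def by simp
qed

lemma Moebius_defect:
  assumes "cmod z < 1" "cmod w < 1"
  shows "1 - (cmod (Moebius_function 0 z w))\<^sup>2 = sech2 z w"
proof -
  have "cmod (Moebius_function 0 z w) = cmod ((z - w) / (1 - cnj z * w))"
    by (simp add: Moebius_function_simple norm_divide norm_minus_commute)
  then show ?thesis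
    using pseudo_hyperbolic_eq_sech2[OF assms] by simp
qed

text \<open>Conjugating by the Moebius maps that send \<open>a\<close> and \<open>f a\<close> to 0 reduces this to the Schwarz lemma.\<close>

lemma Schwarz_Pick:
  assumes f: "f holomorphic_on unit_disk" "f ` unit_disk \<subseteq> unit_disk"
    and ab: "cmod a < 1" "cmod b < 1"
  shows "sech2 a b \<le> sech2 (f a) (f b)"
proof -
  let ?M = "\<lambda>z. Moebius_function 0 z"
  have fd: "cmod (f w) < 1" if "cmod w < 1" for w
    using f(2) that by (auto simp: image_subset_iff)
  define g where "g = ?M (f a) \<circ> (f \<circ> ?M (- a))"
  have M: "?M (- a) ` unit_disk \<subseteq> unit_disk"
    using ab by (auto simp: Moebius_function_norm_lt_1)
  have "g holomorphic_on unit_disk"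
    unfolding g_def
  proof (intro holomorphic_on_compose_gen)
    show "?M (- a) holomorphic_on unit_disk" "?M (f a) holomorphic_on unit_disk"
      using ab fd by (simp_all add: Moebius_function_holomorphic)
    show "(f \<circ> ?M (- a)) ` unit_disk \<subseteq> unit_disk"
      using M f(2) by fastforce
  qed (use f M in auto)
  moreover have "g 0 = 0"
    by (simp add: g_def Moebius_function_of_zero Moebius_function_eq_zero)
  moreover have "cmod (g w) < 1" if "cmod w < 1" for w
    using that fd ab by (simp add: g_def Moebius_function_norm_lt_1)
  moreover have Mab: "cmod (?M a b) < 1"
    using Moebius_function_norm_lt_1 ab by auto
  ultimately have "cmod (g (?M a b)) \<le> cmod (?M a b)"
    using Schwarz_Lemma(1) by blast
  moreover have "g (?M a b) = ?M (f a) (f b)"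
    using Moebius_function_compose[of "- a" a b] ab by (simp add: g_def)
  ultimately have "cmod (?M (f a) (f b)) \<le> cmod (?M a b)"
    by simp
  then have "(cmod (?M (f a) (f b)))\<^sup>2 \<le> (cmod (?M a b))\<^sup>2"
    by (simp add: power_mono)
  then show ?thesis
    using Moebius_defect[OF ab] Moebius_defect[OF fd[OF ab(1)] fd[OF ab(2)]] by linarith
qed

text \<open>For a reference point \<open>z\<close>, the quantities \<open>1 - |w|\<^sup>2\<close> and \<open>S(w,z)\<close> agree up to constant factors, so that this is
  Schwarz-Pick for the pair \<open>w\<close>, \<open>z\<close>.\<close>

lemma Schwarz_Pick_defect:
  assumes f: "f holomorphic_on unit_disk" "f ` unit_disk \<subseteq> unit_disk" and z: "cmod z < 1"
  shows "\<exists>C>0. \<forall>w. cmod w < 1 \<longrightarrow> 1 - (cmod w)\<^sup>2 \<le> C * (1 - (cmod (f w))\<^sup>2)"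
proof -
  have f1: "cmod (f w) < 1" if "cmod w < 1" for w
    using f(2) that by (auto simp: image_subset_iff)
  define D where "D = (1 - (cmod z)\<^sup>2) / 4 * (1 - cmod (f z))\<^sup>2"
  have D: "0 < D"
    using one_minus_power2_pos[OF z] f1[OF z] by (simp add: D_def)
  have "1 - (cmod w)\<^sup>2 \<le> 1 / D * (1 - (cmod (f w))\<^sup>2)" if w: "cmod w < 1" for w
  proof -
    let ?d = "cmod (1 - cnj (f w) * f z)"
    have q: "0 < 1 - (cmod (f w))\<^sup>2" "0 < 1 - (cmod (f z))\<^sup>2"
      using one_minus_power2_pos f1 w z by auto
    have d: "1 - cmod (f z) \<le> ?d"
      using one_minus_norm_le'[of "f w" "f z"] f1[OF w] by simp
    have "(1 - (cmod w)\<^sup>2) * (1 - (cmod z)\<^sup>2) / 4 \<le> sech2 (f w) (f z)"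
      using sech2_ge_defect[OF w z] Schwarz_Pick[OF f w z] by linarith
    also have "\<dots> \<le> (1 - (cmod (f w))\<^sup>2) * 1 / (1 - cmod (f z))\<^sup>2"
      unfolding sech2_def using q d f1[OF z] by (intro frac_le mult_left_mono power_mono) auto
    finally have "(1 - (cmod w)\<^sup>2) * D \<le> 1 - (cmod (f w))\<^sup>2"
      using f1[OF z] by (simp add: D_def field_simps)
    then show ?thesis
      using D by (simp add: field_simps)
  qed
  then show ?thesis
    using D by (intro exI[of _ "1 / D"]) auto
qed

text \<open>Schwarz-Pick for the map and for its inverse.\<close>

lemma sech2_Moebius:
  assumes "cmod z < 1" "cmod a < 1" "cmod b < 1"
  shows "sech2 (Moebius_function 0 z a) (Moebius_function 0 z b) = sech2 a b"
proof (rule antisym)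
  let ?M = "\<lambda>z. Moebius_function 0 z"
  have M: "?M z holomorphic_on unit_disk" "?M (-z) holomorphic_on unit_disk"
    "?M z ` unit_disk \<subseteq> unit_disk" "?M (-z) ` unit_disk \<subseteq> unit_disk"
    using assms by (auto simp: Moebius_function_holomorphic Moebius_function_norm_lt_1)
  show "sech2 a b \<le> sech2 (?M z a) (?M z b)"
    by (rule Schwarz_Pick) (use M assms in auto)
  have "sech2 (?M z a) (?M z b) \<le> sech2 (?M (-z) (?M z a)) (?M (-z) (?M z b))"
    by (rule Schwarz_Pick) (use M assms in \<open>auto simp: Moebius_function_norm_lt_1\<close>)
  then show "sech2 (?M z a) (?M z b) \<le> sech2 a b"
    using assms by (simp add: Moebius_function_compose)
qed

lemma hyp_dist_Moebius:
  assumes "cmod z < 1" "cmod a < 1" "cmod b < 1"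
  shows "hyp_dist (Moebius_function 0 z a) (Moebius_function 0 z b) = hyp_dist a b"
  using assms by (simp add: hyp_dist_eq_sech2 sech2_Moebius Moebius_function_norm_lt_1)

lemma Schwarz_Pick_ball:
  assumes f: "f holomorphic_on ball c r" "f ` ball c r \<subseteq> unit_disk"
    and "0 < r" "w \<in> ball c r"
  shows "1 - (dist c w / r)\<^sup>2 \<le> sech2 (f c) (f w)"
proof -
  define k where "k = (\<lambda>u. c + of_real r * u)"
  have k: "k ` unit_disk \<subseteq> ball c r"
    using \<open>0 < r\<close> by (auto simp: k_def dist_norm norm_mult)
  define u where "u = (w - c) / of_real r"
  have u: "cmod u = dist c w / r" "k u = w" "k 0 = c"
    using \<open>0 < r\<close> by (auto simp: u_def k_def norm_divide dist_norm norm_minus_commute)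
  have "sech2 0 u \<le> sech2 ((f \<circ> k) 0) ((f \<circ> k) u)"
  proof (rule Schwarz_Pick)
    have "k holomorphic_on unit_disk"
      unfolding k_def by (intro holomorphic_intros)
    then show "f \<circ> k holomorphic_on unit_disk"
      by (rule holomorphic_on_compose_gen[OF _ f(1)]) (use k in auto)
    show "(f \<circ> k) ` unit_disk \<subseteq> unit_disk"
      using f(2) k by fastforce
  qed (use u assms in auto)
  then show ?thesis
    using u by (simp add: sech2_def)
qed

text \<open>The endpoints of a path in \<open>\<Delta>\<close> have a distance in \<open>\<Delta>\<close> that no holomorphic map into the disk increases; the
  uniform bound is obtained by chaining disks in \<open>\<Delta>\<close> along the path.\<close>

lemma sech2_along_path:
  assumes \<Delta>: "open \<Delta>" and \<gamma>: "continuous_on {0..1::real} \<gamma>" "\<gamma> ` {0..1} \<subseteq> \<Delta>"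
  shows "\<exists>k>0. \<forall>f. f holomorphic_on \<Delta> \<longrightarrow> f ` \<Delta> \<subseteq> unit_disk \<longrightarrow> (\<forall>s\<in>{0..1}. k \<le> sech2 (f (\<gamma> 0)) (f (\<gamma> s)))"
proof -
  have comp: "compact (\<gamma> ` {0..1})"
    using \<gamma>(1) by (intro compact_continuous_image) auto
  obtain e where e: "0 < e" "(\<Union>x\<in>\<gamma> ` {0..1}. ball x e) \<subseteq> \<Delta>"
    by (rule compact_subset_open_imp_ball_epsilon_subset[OF comp \<Delta> \<gamma>(2)])
  have "uniformly_continuous_on {0..1} \<gamma>"
    using \<gamma>(1) by (simp add: compact_uniformly_continuous)
  then obtain d where d: "0 < d" "\<And>s s'. s \<in> {0..1} \<Longrightarrow> s' \<in> {0..1} \<Longrightarrow> dist s s' < d \<Longrightarrow> dist (\<gamma> s) (\<gamma> s') < e / 2"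
    unfolding uniformly_continuous_on_def using e(1) by (metis half_gt_zero dist_commute)
  define F where "F = {f. f holomorphic_on \<Delta> \<and> f ` \<Delta> \<subseteq> unit_disk}"
  have F1: "cmod (f (\<gamma> s)) < 1" if "f \<in> F" "s \<in> {0..1}" for f s
    using that \<gamma>(2) by (auto simp: F_def image_subset_iff)
  \<comment> \<open>On \<open>ball (\<gamma> s) e\<close> the point \<open>\<gamma> s'\<close> has relative distance at most 1/2 from the centre, and \<open>1 - (1/2)\<^sup>2 = 3/4\<close>.\<close>
  have local: "3 / 4 \<le> sech2 (f (\<gamma> s)) (f (\<gamma> s'))"
    if "f \<in> F" "s \<in> {0..1}" "s' \<in> {0..1}" "dist s s' < d" for f s s'
  proof -
    have b: "ball (\<gamma> s) e \<subseteq> \<Delta>"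
      using e(2) that(2) by blast
    have dd: "dist (\<gamma> s) (\<gamma> s') < e / 2"
      using d(2) that by blast
    have "dist (\<gamma> s) (\<gamma> s') / e \<le> 1 / 2"
      using dd e(1) by (simp add: field_simps)
    then have "(dist (\<gamma> s) (\<gamma> s') / e)\<^sup>2 \<le> (1 / 2)\<^sup>2"
      using e(1) by (intro power_mono) auto
    moreover have "1 - (dist (\<gamma> s) (\<gamma> s') / e)\<^sup>2 \<le> sech2 (f (\<gamma> s)) (f (\<gamma> s'))"
      using that(1) b dd e(1) by (intro Schwarz_Pick_ball) (auto simp: F_def intro: holomorphic_on_subset)
    ultimately show ?thesis
      by (simp add: power2_eq_square)
  qed
  \<comment> \<open>Steps of length \<open>d / 2\<close> satisfy the strict bound \<open>d\<close> of uniform continuity.\<close>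
  have chain: "\<exists>k>0. \<forall>f\<in>F. \<forall>s\<in>{0..1}. s \<le> real n * (d / 2) \<longrightarrow> k \<le> sech2 (f (\<gamma> 0)) (f (\<gamma> s))" for n
  proof (induction n)
    case 0
    have "3 / 4 \<le> sech2 (f (\<gamma> 0)) (f (\<gamma> s))" if "f \<in> F" "s \<in> {0..1}" "s \<le> real 0 * (d / 2)" for f s
      using that d(1) by (intro local) auto
    then show ?case
      by (intro exI[of _ "3 / 4"]) auto
  next
    case (Suc n)
    then obtain k where k: "0 < k" "\<And>f s. f \<in> F \<Longrightarrow> s \<in> {0..1} \<Longrightarrow> s \<le> real n * (d / 2) \<Longrightarrow> k \<le> sech2 (f (\<gamma> 0)) (f (\<gamma> s))"
      by blast
    obtain k' where k': "0 < k'" "\<And>a b c. cmod a < 1 \<Longrightarrow> cmod b < 1 \<Longrightarrow> cmod c < 1 \<Longrightarrow>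
        k \<le> sech2 a b \<Longrightarrow> 3 / 4 \<le> sech2 b c \<Longrightarrow> k' \<le> sech2 a c"
      using sech2_quasi_triangle[OF k(1), of "3 / 4"] by auto
    have "k' \<le> sech2 (f (\<gamma> 0)) (f (\<gamma> s))" if f: "f \<in> F" and s: "s \<in> {0..1}" "s \<le> real (Suc n) * (d / 2)" for f s
    proof -
      define s' where "s' = max 0 (s - d / 2)"
      have s': "s' \<in> {0..1}" "s' \<le> real n * (d / 2)" "dist s' s < d"
        using s d(1) mult_nonneg_nonneg[of d "real n"] by (auto simp: s'_def max_def dist_real_def algebra_simps)
      show ?thesis
        by (rule k'(2)[of _ "f (\<gamma> s')"]) (use f s s' F1 k(2) local in auto)
    qed
    then show ?case
      using k'(1) by blast
  qed
  obtain n where "1 / (d / 2) \<le> real n"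
    using real_arch_simple by blast
  then have n: "1 \<le> real n * (d / 2)"
    using d(1) by (simp add: field_simps)
  obtain k where "0 < k" "\<And>f s. f \<in> F \<Longrightarrow> s \<in> {0..1} \<Longrightarrow> s \<le> real n * (d / 2) \<Longrightarrow> k \<le> sech2 (f (\<gamma> 0)) (f (\<gamma> s))"
    using chain[of n] by blast
  then show ?thesis
    using n by (intro exI[of _ k]) (auto simp: F_def)
qed

section \<open>The right half-plane\<close>

definition cayley :: "complex \<Rightarrow> complex" where
  "cayley s = (s - 1) / (s + 1)"

lemma Re_pos_add_1_neq_0: "0 < Re s \<Longrightarrow> s + 1 \<noteq> 0"
  by (auto simp: complex_eq_iff)

lemma cayley_defect:
  assumes "0 < Re s"
  shows "1 - (cmod (cayley s))\<^sup>2 = 4 * Re s / (cmod (s + 1))\<^sup>2"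
proof -
  have "cmod (s + 1) \<noteq> 0"
    using assms Re_pos_add_1_neq_0 by auto
  moreover have "(cmod (s - 1))\<^sup>2 = (cmod (s + 1))\<^sup>2 - 4 * Re s"
    by (simp add: cmod_power2) (simp add: power2_eq_square algebra_simps)
  ultimately show ?thesis
    unfolding cayley_def norm_divide power_divide by (simp add: diff_divide_distrib)
qed

lemma cayley_in_disk:
  assumes "0 < Re s"
  shows "cmod (cayley s) < 1"
proof -
  have "0 < 1 - (cmod (cayley s))\<^sup>2"
    unfolding cayley_defect[OF assms] using assms Re_pos_add_1_neq_0 by auto
  then show ?thesis
    by (simp add: abs_square_less_1)
qed

lemma sech2_cayley:
  assumes "0 < Re s" "0 < Re t"
  shows "sech2 (cayley s) (cayley t) = 4 * Re s * Re t / (cmod (cnj s + t))\<^sup>2"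
proof -
  have nz: "s + 1 \<noteq> 0" "t + 1 \<noteq> 0" "cnj s + 1 \<noteq> 0" "cnj s + t \<noteq> 0"
    using assms by (auto simp: complex_eq_iff)
  have "1 - cnj (cayley s) * cayley t = 2 * (cnj s + t) / ((cnj s + 1) * (t + 1))"
    using nz by (simp add: cayley_def divide_simps) (simp add: algebra_simps)
  moreover have "cmod (cnj s + 1) = cmod (s + 1)"
    by (metis complex_cnj_add complex_cnj_one complex_mod_cnj)
  ultimately have d: "cmod (1 - cnj (cayley s) * cayley t) = 2 * cmod (cnj s + t) / (cmod (s + 1) * cmod (t + 1))"
    by (simp add: norm_mult norm_divide del: distrib_left_numeral)
  then show ?thesis
    using nz unfolding sech2_def cayley_defect[OF assms(1)] cayley_defect[OF assms(2)] d
    by (simp add: power_divide power_mult_distrib)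
qed

text \<open>The left-hand side is the analogue of \<open>S\<close> for the right half-plane, transported by the Cayley map.\<close>

lemma Schwarz_Pick_right_half_plane:
  assumes f: "f holomorphic_on {s. 0 < Re s}" "f ` {s. 0 < Re s} \<subseteq> unit_disk"
    and "0 < Re s" "0 < Re t"
  shows "4 * Re s * Re t / (cmod (cnj s + t))\<^sup>2 \<le> sech2 (f s) (f t)"
proof -
  \<comment> \<open>The inverse of the Cayley map.\<close>
  define k where "k = (\<lambda>w::complex. (1 + w) / (1 - w))"
  have Rek: "0 < Re (k w)" if "cmod w < 1" for w
  proof -
    have nz: "1 - w \<noteq> 0"
      using that by auto
    have "k w = (1 + w) * cnj (1 - w) / of_real ((cmod (1 - w))\<^sup>2)"
      unfolding k_def using nz complex_div_cnj by blast
    then have "Re (k w) = Re ((1 + w) * cnj (1 - w)) / (cmod (1 - w))\<^sup>2"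
      by (simp only: Re_divide_of_real)
    also have "Re ((1 + w) * cnj (1 - w)) = 1 - (cmod w)\<^sup>2"
      by (simp add: cmod_power2) (simp add: power2_eq_square algebra_simps)
    finally show ?thesis
      using nz one_minus_power2_pos[OF that] by auto
  qed
  have kc: "k (cayley u) = u" if "0 < Re u" for u
  proof -
    have "u + 1 \<noteq> 0"
      using that Re_pos_add_1_neq_0 by auto
    then show ?thesis
      by (simp add: k_def cayley_def divide_simps)
  qed
  have "sech2 (cayley s) (cayley t) \<le> sech2 ((f \<circ> k) (cayley s)) ((f \<circ> k) (cayley t))"
  proof (rule Schwarz_Pick)
    have "k holomorphic_on unit_disk"
      unfolding k_def by (intro holomorphic_intros) auto
    then show "f \<circ> k holomorphic_on unit_disk"
      by (rule holomorphic_on_compose_gen[OF _ f(1)]) (use Rek in auto)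
    show "(f \<circ> k) ` unit_disk \<subseteq> unit_disk"
      using f(2) Rek by fastforce
  qed (use assms cayley_in_disk in auto)
  then show ?thesis
    using assms by (simp add: kc sech2_cayley)
qed

text \<open>The square root maps the plane slit along the negative half-line onto the right half-plane. With \<open>v = csqrt u\<close>, a
  point \<open>u\<close> far to the left but of bounded imaginary part has \<open>Im v\<close> of order \<open>sqrt L\<close> and, because
  \<open>Im u = 2 Re v Im v\<close>, a real part \<open>Re v\<close> of order \<open>1 / sqrt L\<close>; this gives the exponent 3/2.\<close>

lemma cayley_csqrt_defect_le:
  assumes L: "0 < L" "Re u \<le> - L" "\<bar>Im u\<bar> \<le> m" and pos: "0 < Re (csqrt u)"
  shows "1 - (cmod (cayley (csqrt u)))\<^sup>2 \<le> 2 * m / (L * sqrt L)"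
proof -
  define v where "v = csqrt u"
  have v2: "v\<^sup>2 = u"
    by (simp add: v_def)
  have v0: "0 < Re v"
    using pos by (simp add: v_def)
  have re: "(Re v)\<^sup>2 - (Im v)\<^sup>2 = Re u" and im: "2 * Re v * Im v = Im u"
    unfolding v2[symmetric] by (simp_all add: Re_power2 Im_power2)
  have "L \<le> (Im v)\<^sup>2"
    using re L(2) zero_le_power2[of "Re v"] by linarith
  then have sL: "sqrt L \<le> \<bar>Im v\<bar>"
    using real_sqrt_le_mono by fastforce
  have "2 * Re v * sqrt L \<le> 2 * Re v * \<bar>Im v\<bar>"
    using sL v0 by (intro mult_left_mono) auto
  also have "\<dots> = \<bar>Im u\<bar>"
    unfolding im[symmetric] using v0 by (simp add: abs_mult)
  finally have rv: "Re v \<le> m / (2 * sqrt L)"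
    using L by (simp add: field_simps)
  have "0 \<le> Re v" "L \<le> cmod u"
    using v0 L(2) abs_Re_le_cmod[of u] by linarith+
  moreover have "cmod u = (cmod v)\<^sup>2"
    unfolding v2[symmetric] by (simp add: norm_power)
  moreover have "(cmod v)\<^sup>2 \<le> (cmod (v + 1))\<^sup>2"
    unfolding cmod_power2 using v0 by (simp add: power2_eq_square algebra_simps)
  ultimately have "0 \<le> Re v" "L \<le> (cmod (v + 1))\<^sup>2"
    by linarith+
  then have "4 * Re v / (cmod (v + 1))\<^sup>2 \<le> 4 * (m / (2 * sqrt L)) / L"
    using rv L by (intro frac_le mult_left_mono) auto
  then show ?thesis
    using cayley_defect[OF v0] L by (simp add: v_def mult.commute)
qed

section \<open>Horocycles and Julia's lemma\<close>

text \<open>For \<open>|p| = 1\<close> the sublevel sets are the horodisks at \<open>p\<close>, and the logarithm is twice the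
  Busemann function of \<open>p\<close>.\<close>

definition horocycle_level :: "complex \<Rightarrow> complex \<Rightarrow> real" where
  "horocycle_level p w = (cmod (1 - cnj p * w))\<^sup>2 / (1 - (cmod w)\<^sup>2)"

lemma norm_one_minus_cnj_unit:
  assumes "cmod p = 1"
  shows "cmod (1 - cnj p * w) = cmod (p - w)"
  using norm_one_minus_cnj_mult[of p w] assms by simp

lemma horocycle_level_pos:
  assumes "cmod p = 1" "cmod w < 1"
  shows "0 < horocycle_level p w"
  using assms one_minus_cnj_mult_pos[of w p] one_minus_power2_pos[of w]
  by (simp add: horocycle_level_def norm_one_minus_cnj_commute[of p])

text \<open>Schwarz-Pick for the pairs \<open>a n\<close>, \<open>x\<close>, divided by \<open>1 - |a n|\<^sup>2\<close>, in the limit \<open>n \<rightarrow> \<infinity>\<close>.\<close>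

lemma Julia_ratio:
  assumes f: "f holomorphic_on unit_disk" "f ` unit_disk \<subseteq> unit_disk"
    and a: "\<And>n::nat. cmod (a n) < 1" "a \<longlonglongrightarrow> p" "(\<lambda>n. f (a n)) \<longlonglongrightarrow> p"
    and ratio: "\<exists>\<^sub>F n in sequentially. 1 - (cmod (f (a n)))\<^sup>2 \<le> r * (1 - (cmod (a n))\<^sup>2)"
    and x: "cmod x < 1"
  shows "(cmod (1 - cnj p * f x))\<^sup>2 * (1 - (cmod x)\<^sup>2)
       \<le> r * ((1 - (cmod (f x))\<^sup>2) * (cmod (1 - cnj p * x))\<^sup>2)"
proof (rule ccontr)
  define L where "L = (\<lambda>n. (cmod (1 - cnj (f (a n)) * f x))\<^sup>2 * (1 - (cmod x)\<^sup>2))"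
  define R where "R = (\<lambda>n. r * ((1 - (cmod (f x))\<^sup>2) * (cmod (1 - cnj (a n) * x))\<^sup>2))"
  assume "\<not> ?thesis"
  then have "0 < (cmod (1 - cnj p * f x))\<^sup>2 * (1 - (cmod x)\<^sup>2)
       - r * ((1 - (cmod (f x))\<^sup>2) * (cmod (1 - cnj p * x))\<^sup>2)" (is "0 < ?D")
    by simp
  moreover have "(\<lambda>n. L n - R n) \<longlonglongrightarrow> ?D"
    unfolding L_def R_def by (intro tendsto_intros a)
  ultimately have ev: "\<forall>\<^sub>F n in sequentially. 0 < L n - R n"
    by (rule order_tendstoD(1)[rotated])
  have "\<exists>\<^sub>F n in sequentially. 0 < L n - R n \<and> 1 - (cmod (f (a n)))\<^sup>2 \<le> r * (1 - (cmod (a n))\<^sup>2)"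
    using ratio by (rule frequently_rev_mp) (use ev in eventually_elim, auto)
  then obtain n where n: "R n < L n" "1 - (cmod (f (a n)))\<^sup>2 \<le> r * (1 - (cmod (a n))\<^sup>2)"
    using frequently_ex by fastforce
  have fx: "cmod (f x) < 1" "cmod (f (a n)) < 1"
    using f(2) x a(1) by (auto simp: image_subset_iff)
  have d: "0 < cmod (1 - cnj (f (a n)) * f x)" "0 < cmod (1 - cnj (a n) * x)"
    using one_minus_cnj_mult_pos fx x a(1) by auto
  let ?q = "1 - (cmod (a n))\<^sup>2"
  have q: "0 < ?q" "0 < 1 - (cmod x)\<^sup>2" "0 < 1 - (cmod (f x))\<^sup>2"
    using one_minus_power2_pos a(1) x fx by auto
  have "sech2 (a n) x \<le> sech2 (f (a n)) (f x)"
    by (rule Schwarz_Pick[OF f a(1) x])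
  then have "?q * L n \<le> (1 - (cmod (f (a n)))\<^sup>2) * ((1 - (cmod (f x))\<^sup>2) * (cmod (1 - cnj (a n) * x))\<^sup>2)"
    using d by (simp add: sech2_def L_def field_simps)
  also have "\<dots> \<le> (r * ?q) * ((1 - (cmod (f x))\<^sup>2) * (cmod (1 - cnj (a n) * x))\<^sup>2)"
    using n(2) q by (intro mult_right_mono) auto
  also have "\<dots> = ?q * R n"
    by (simp add: R_def)
  finally show False
    using n(1) q by simp
qed

text \<open>Julia's lemma in the case where the boundary dilation, measured along one sequence, is at most 1: the horodisks
  at \<open>p\<close> are invariant.\<close>

lemma Julia_horocycle:
  assumes f: "f holomorphic_on unit_disk" "f ` unit_disk \<subseteq> unit_disk"
    and a: "\<And>n::nat. cmod (a n) < 1" "a \<longlonglongrightarrow> p" "(\<lambda>n. f (a n)) \<longlonglongrightarrow> p"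
    and ratio: "\<And>r. 1 < r \<Longrightarrow> \<exists>\<^sub>F n in sequentially. 1 - (cmod (f (a n)))\<^sup>2 \<le> r * (1 - (cmod (a n))\<^sup>2)"
    and x: "cmod x < 1"
  shows "horocycle_level p (f x) \<le> horocycle_level p x"
proof -
  let ?A = "(cmod (1 - cnj p * f x))\<^sup>2 * (1 - (cmod x)\<^sup>2)"
  let ?B = "(1 - (cmod (f x))\<^sup>2) * (cmod (1 - cnj p * x))\<^sup>2"
  have fx: "cmod (f x) < 1"
    using f(2) x by (auto simp: image_subset_iff)
  have q: "0 < 1 - (cmod x)\<^sup>2" "0 < 1 - (cmod (f x))\<^sup>2"
    using one_minus_power2_pos x fx by auto
  have B: "0 \<le> ?B"
    using q by simp
  \<comment> \<open>The factor \<open>r = 1 + e / (?B + 1)\<close> is chosen so that \<open>r ?B \<le> ?B + e\<close>.\<close>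
  have "?A \<le> ?B + e" if "0 < e" for e
  proof -
    have "?A \<le> (1 + e / (?B + 1)) * ?B"
      using that B by (intro Julia_ratio[OF f a ratio x]) auto
    also have "\<dots> = ?B + e * (?B / (?B + 1))"
      by (simp add: algebra_simps)
    also have "\<dots> \<le> ?B + e"
      using that B by (simp add: field_simps)
    finally show ?thesis .
  qed
  then have "?A \<le> ?B"
    by (rule field_le_epsilon)
  then show ?thesis
    using q by (simp add: horocycle_level_def field_simps)
qed

text \<open>The transformation rule of the kernel \<open>1 - cnj a b\<close>, also valid for boundary points.\<close>

lemma one_minus_cnj_Moebius:
  assumes "cmod z < 1" "cmod a \<le> 1" "cmod b \<le> 1"
  shows "cmod (1 - cnj (Moebius_function 0 z a) * Moebius_function 0 z b)
     = (1 - (cmod z)\<^sup>2) * cmod (1 - cnj a * b) / (cmod (1 - cnj z * a) * cmod (1 - cnj z * b))"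
proof -
  have nz: "1 - cnj z * a \<noteq> 0" "1 - cnj z * b \<noteq> 0" "1 - z * cnj a \<noteq> 0"
    using one_minus_cnj_mult_pos[of z a] one_minus_cnj_mult_pos[of z b] norm_one_minus_cnj_commute[of z a] assms
    by (auto simp: mult.commute)
  have "1 - cnj (Moebius_function 0 z a) * Moebius_function 0 z b
    = (1 - cnj z * z) * (1 - cnj a * b) / ((1 - z * cnj a) * (1 - cnj z * b))"
    using nz by (simp add: Moebius_function_simple divide_simps) (simp add: algebra_simps)
  also have "cmod \<dots> = cmod (1 - cnj z * z) * cmod (1 - cnj a * b) / (cmod (1 - z * cnj a) * cmod (1 - cnj z * b))"
    by (simp only: norm_mult norm_divide)
  also have "1 - cnj z * z = of_real (1 - (cmod z)\<^sup>2)"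
    unfolding of_real_diff complex_norm_square by (simp add: mult.commute)
  also have "cmod (of_real (1 - (cmod z)\<^sup>2)) = 1 - (cmod z)\<^sup>2"
    using one_minus_power2_pos[OF assms(1)] by (simp only: norm_of_real)
  also have "cmod (1 - z * cnj a) = cmod (1 - cnj z * a)"
    using norm_one_minus_cnj_commute[of z a] by (simp add: mult.commute)
  finally show ?thesis .
qed

lemma Moebius_unit:
  assumes "cmod z < 1" "cmod p = 1"
  shows "cmod (Moebius_function 0 z p) = 1"
proof -
  have "cmod (1 - cnj z * p) \<noteq> 0"
    using one_minus_cnj_mult_pos[of z p] assms by auto
  moreover have "(cmod (1 - cnj z * p))\<^sup>2 = (cmod (z - p))\<^sup>2"
    using norm_one_minus_cnj_mult[of z p] assms by simp
  then have "cmod (1 - cnj z * p) = cmod (z - p)"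
    by simp
  ultimately show ?thesis
    by (simp add: Moebius_function_simple norm_divide norm_minus_commute)
qed

text \<open>A Moebius map carries horodisks at \<open>p\<close> to horodisks at its image; the level of \<open>z\<close>, whose image is 0,
  becomes 1.\<close>

lemma horocycle_level_Moebius:
  assumes "cmod z < 1" "cmod w < 1" "cmod p = 1"
  shows "horocycle_level (Moebius_function 0 z p) (Moebius_function 0 z w) = horocycle_level p w / horocycle_level p z"
proof -
  have pos: "0 < cmod (1 - cnj z * p)" "0 < cmod (1 - cnj z * w)" "0 < 1 - (cmod z)\<^sup>2" "0 < 1 - (cmod w)\<^sup>2"
    using one_minus_cnj_mult_pos[of z] one_minus_power2_pos assms by auto
  have "horocycle_level (Moebius_function 0 z p) (Moebius_function 0 z w)
    = ((1 - (cmod z)\<^sup>2) * cmod (1 - cnj p * w) / (cmod (1 - cnj z * p) * cmod (1 - cnj z * w)))\<^sup>2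
      / ((1 - (cmod z)\<^sup>2) * (1 - (cmod w)\<^sup>2) / (cmod (1 - cnj z * w))\<^sup>2)"
    using assms by (simp add: horocycle_level_def one_minus_cnj_Moebius Moebius_defect sech2_def)
  also have "\<dots> = (1 - (cmod z)\<^sup>2) * (cmod (1 - cnj p * w))\<^sup>2 / ((cmod (1 - cnj z * p))\<^sup>2 * (1 - (cmod w)\<^sup>2))"
    using pos by (simp add: power_divide power_mult_distrib divide_simps) (simp add: power2_eq_square)
  also have "\<dots> = horocycle_level p w / horocycle_level p z"
    unfolding horocycle_level_def norm_one_minus_cnj_commute[of z p] by (simp add: mult.commute)
  finally show ?thesis .
qed

section \<open>Geodesics and the distance to them\<close>

lemma artanh_inj:
  assumes "0 \<le> x" "x < 1" "0 \<le> y" "y < 1" "artanh x = artanh (y::real)"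
  shows "x = y"
proof -
  have "(1 + x) / (1 - x) = (1 + y) / (1 - y)"
    using assms by (simp add: artanh_def)
  then show ?thesis
    using assms by (simp add: field_simps)
qed

lemma artanh_add:
  assumes "0 \<le> x" "x < 1" "0 \<le> y" "y < (1::real)"
  shows "artanh x + artanh y = artanh ((x + y) / (1 + x * y))"
proof -
  have p: "0 < 1 + x * y"
    using assms by (simp add: add_pos_nonneg)
  have 1: "1 + (x + y) / (1 + x * y) = (1 + x) * (1 + y) / (1 + x * y)"
    using p by (simp add: field_simps)
  have 2: "1 - (x + y) / (1 + x * y) = (1 - x) * (1 - y) / (1 + x * y)"
    using p by (simp add: field_simps)
  have "(1 + (x + y) / (1 + x * y)) / (1 - (x + y) / (1 + x * y)) = ((1 + x) / (1 - x)) * ((1 + y) / (1 - y))"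
    unfolding 1 2 using p by simp
  moreover have "ln (((1 + x) / (1 - x)) * ((1 + y) / (1 - y))) = ln ((1 + x) / (1 - x)) + ln ((1 + y) / (1 - y))"
    using assms by (intro ln_mult_pos) auto
  ultimately show ?thesis
    by (simp add: artanh_def add_divide_distrib)
qed

text \<open>Equality in the triangle inequality through 0: the addition theorem of \<open>artanh\<close> turns it into
  \<open>|1 - cnj a b| = 1 + |a| |b|\<close>, and this holds only if \<open>cnj a b\<close> is a nonpositive real number.\<close>

lemma opposite_if_hyp_dist_add:
  assumes ab: "cmod a < 1" "cmod b < 1"
    and add: "hyp_dist a b = hyp_dist a 0 + hyp_dist 0 b"
  shows "cnj a * b = - of_real (cmod a * cmod b)"
proof -
  let ?x = "cmod a" and ?y = "cmod b"
  let ?q = "(?x + ?y) / (1 + ?x * ?y)" and ?d = "cmod (1 - cnj a * b)"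
  have p: "0 < 1 + ?x * ?y"
    by (simp add: add_pos_nonneg)
  have e: "1 - ?q\<^sup>2 = (1 - ?x\<^sup>2) * (1 - ?y\<^sup>2) / (1 + ?x * ?y)\<^sup>2"
    using p by (simp add: power_divide field_simps) (simp add: power2_eq_square algebra_simps)
  have "0 < (1 - ?x\<^sup>2) * (1 - ?y\<^sup>2)"
    using one_minus_power2_pos ab by auto
  then have "0 < 1 - ?q\<^sup>2"
    using p unfolding e by auto
  then have q: "0 \<le> ?q" "?q < 1"
    using p by (auto simp: abs_square_less_1)
  define r where "r = cmod ((a - b) / (1 - cnj a * b))"
  have r2: "r\<^sup>2 = 1 - sech2 a b"
    using pseudo_hyperbolic_eq_sech2[OF ab] by (simp add: r_def)
  then have "r\<^sup>2 < 1" "0 \<le> r"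
    using sech2_pos[OF ab] by (auto simp: r_def)
  then have r: "0 \<le> r" "r < 1"
    by (auto simp: abs_square_less_1)
  have "artanh r = artanh ?x + artanh ?y"
    using add by (simp add: hyp_dist_def r_def)
  then have "artanh r = artanh ?q"
    using artanh_add[of ?x ?y] ab by simp
  then have "r = ?q"
    using r q artanh_inj by blast
  then have "sech2 a b = (1 - ?x\<^sup>2) * (1 - ?y\<^sup>2) / (1 + ?x * ?y)\<^sup>2"
    using r2 e by simp
  then have "(1 - ?x\<^sup>2) * (1 - ?y\<^sup>2) / ?d\<^sup>2 = (1 - ?x\<^sup>2) * (1 - ?y\<^sup>2) / (1 + ?x * ?y)\<^sup>2"
    by (simp add: sech2_def)
  then have "?d\<^sup>2 = (1 + ?x * ?y)\<^sup>2"
    using \<open>0 < (1 - ?x\<^sup>2) * (1 - ?y\<^sup>2)\<close> by (metis divide_cancel_left less_irrefl)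
  then have d: "?d = 1 + ?x * ?y"
    by (rule power2_eq_imp_eq) (use p in \<open>simp_all only: norm_ge_zero less_imp_le\<close>)
  define c where "c = cnj a * b"
  have c: "cmod c = ?x * ?y"
    by (simp add: c_def norm_mult)
  have "cmod (1 - c) = 1 + cmod c"
    using d unfolding c by (simp only: c_def)
  then have "(1 - Re c)\<^sup>2 + (Im c)\<^sup>2 = (1 + cmod c)\<^sup>2"
    using cmod_power2[of "1 - c"] by simp
  moreover have "(Re c)\<^sup>2 + (Im c)\<^sup>2 = (cmod c)\<^sup>2"
    by (simp add: cmod_power2)
  ultimately have "Re c = - cmod c"
    by (simp add: power2_eq_square algebra_simps)
  moreover from this have "Im c = 0"
    using cmod_power2[of c] by simp
  ultimately show ?thesis
    unfolding c_def[symmetric] c[symmetric] by (simp add: complex_eq_iff)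
qed

text \<open>The image of a geodesic through \<open>z\<close> under the Moebius map sending \<open>z\<close> to 0 lies on the diameter
  through \<open>q\<close>, because any two points on different sides of 0 are opposite to each other. By continuity it covers
  the radius ending at \<open>q\<close>.\<close>

lemma full_geodesic_normalized:
  assumes geo: "full_geodesic \<eta>" and z: "\<eta> 0 = z" and lim: "(\<eta> \<longlongrightarrow> p) (at_left 1)"
  defines "q \<equiv> Moebius_function 0 z p"
  shows "cmod q = 1"
    and "\<And>r. r \<in> {-1<..<1} \<Longrightarrow> \<exists>x\<in>{-1<..<1}. Moebius_function 0 z (\<eta> r) = of_real x * q"
    and "\<And>x. 0 \<le> x \<Longrightarrow> x < 1 \<Longrightarrow> \<exists>r\<in>{-1<..<1}. Moebius_function 0 z (\<eta> r) = of_real x * q"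
proof -
  let ?M = "Moebius_function 0 z"
  define \<zeta> where "\<zeta> = (\<lambda>r. ?M (\<eta> r))"
  have cont: "continuous_on {-1<..<1} \<eta>" and inj: "inj_on \<eta> {-1<..<1}"
    and img: "\<And>r. r \<in> {-1<..<1} \<Longrightarrow> cmod (\<eta> r) < 1"
    and add: "\<And>r s u. -1 < r \<Longrightarrow> r \<le> s \<Longrightarrow> s \<le> u \<Longrightarrow> u < 1 \<Longrightarrow>
        hyp_dist (\<eta> r) (\<eta> u) = hyp_dist (\<eta> r) (\<eta> s) + hyp_dist (\<eta> s) (\<eta> u)"
    and bd: "((\<lambda>r. cmod (\<eta> r)) \<longlongrightarrow> 1) (at_left 1)"
    using geo unfolding full_geodesic_def by (auto simp: image_subset_iff)
  have z1: "cmod z < 1"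
    using img[of 0] z by simp
  have p1: "cmod p = 1"
    using tendsto_unique[OF _ tendsto_norm[OF lim] bd] by simp
  show q1: "cmod q = 1"
    unfolding q_def by (rule Moebius_unit[OF z1 p1])
  have \<zeta>1: "cmod (\<zeta> r) < 1" if "r \<in> {-1<..<1}" for r
    unfolding \<zeta>_def using that img z1 by (intro Moebius_function_norm_lt_1) auto
  have \<zeta>0: "\<zeta> 0 = 0"
    by (simp add: \<zeta>_def z Moebius_function_eq_zero)
  have opp: "cnj (\<zeta> r) * \<zeta> u = - of_real (cmod (\<zeta> r) * cmod (\<zeta> u))" if "-1 < r" "r \<le> 0" "0 \<le> u" "u < 1" for r u
  proof (rule opposite_if_hyp_dist_add)
    have "hyp_dist (\<zeta> r) (\<zeta> u) = hyp_dist (\<zeta> r) (\<zeta> 0) + hyp_dist (\<zeta> 0) (\<zeta> u)"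
      using add[OF that] that img z1 by (simp add: \<zeta>_def hyp_dist_Moebius)
    then show "hyp_dist (\<zeta> r) (\<zeta> u) = hyp_dist (\<zeta> r) 0 + hyp_dist 0 (\<zeta> u)"
      by (simp add: \<zeta>0)
  qed (use \<zeta>1 that in auto)
  have lim\<zeta>: "(\<zeta> \<longlongrightarrow> q) (at_left 1)"
    unfolding \<zeta>_def q_def Moebius_function_simple
    using one_minus_cnj_mult_pos[of z p] z1 p1 by (intro tendsto_intros lim) auto
  have near1: "\<forall>\<^sub>F u in at_left 1. 0 \<le> u \<and> u < (1::real)"
    unfolding eventually_at_left_field by (intro exI[of _ 0]) auto
  \<comment> \<open>In \<open>opp\<close> let \<open>u\<close> tend to the end of the geodesic at \<open>p\<close>.\<close>
  have neg: "\<zeta> r = - of_real (cmod (\<zeta> r)) * q" if "-1 < r" "r \<le> 0" for r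
  proof -
    have "((\<lambda>u. cnj (\<zeta> r) * \<zeta> u) \<longlongrightarrow> cnj (\<zeta> r) * q) (at_left 1)"
      by (intro tendsto_intros lim\<zeta>)
    moreover have "((\<lambda>u. - of_real (cmod (\<zeta> r) * cmod (\<zeta> u))) \<longlongrightarrow> - complex_of_real (cmod (\<zeta> r) * cmod q)) (at_left 1)"
      by (intro tendsto_intros lim\<zeta>)
    then have "((\<lambda>u. cnj (\<zeta> r) * \<zeta> u) \<longlongrightarrow> - complex_of_real (cmod (\<zeta> r) * cmod q)) (at_left 1)"
      by (rule Lim_transform_eventually) (use near1 in eventually_elim, use opp that in auto)
    ultimately have "cnj (\<zeta> r) * q = - complex_of_real (cmod (\<zeta> r))"
      using tendsto_unique[OF trivial_limit_at_left_real] q1 by fastforce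
    then have "\<zeta> r * (cnj q * q) = - complex_of_real (cmod (\<zeta> r)) * q"
      by (metis complex_cnj_cnj complex_cnj_complex_of_real complex_cnj_minus complex_cnj_mult mult.assoc)
    then show ?thesis
      using q1 by (simp add: complex_norm_square[symmetric] mult.commute[of "cnj q"])
  qed
  \<comment> \<open>The points with positive parameter are opposite to a fixed one with negative parameter, which is nonzero by injectivity.\<close>
  have pos: "\<zeta> u = of_real (cmod (\<zeta> u)) * q" if "0 \<le> u" "u < 1" for u
  proof -
    let ?r = "- 1 / 2 :: real"
    have "\<eta> ?r \<noteq> \<eta> 0"
      using inj_onD[OF inj, of ?r 0] by auto
    then have nz: "\<zeta> ?r \<noteq> 0"
      using img[of ?r] img[of 0] z1 z one_minus_cnj_mult_pos[of z "\<eta> ?r"]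
      by (auto simp: \<zeta>_def Moebius_function_simple)
    have "cnj (\<zeta> ?r) = - of_real (cmod (\<zeta> ?r)) * cnj q"
      using arg_cong[OF neg[of ?r], of cnj] by simp
    then have "- of_real (cmod (\<zeta> ?r)) * (cnj q * \<zeta> u) = - of_real (cmod (\<zeta> ?r)) * of_real (cmod (\<zeta> u))"
      using opp[of ?r u] that by simp
    then have "cnj q * \<zeta> u = of_real (cmod (\<zeta> u))"
      using nz by simp
    then have "(q * cnj q) * \<zeta> u = of_real (cmod (\<zeta> u)) * q"
      by (simp add: mult.assoc)
    then show ?thesis
      using q1 by (simp add: complex_norm_square[symmetric])
  qed
  show "\<exists>x\<in>{-1<..<1}. ?M (\<eta> r) = of_real x * q" if "r \<in> {-1<..<1}" for r
  proof (cases "r \<le> 0")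
    case True
    then show ?thesis
      using neg[of r] \<zeta>1[of r] that
      by (intro bexI[of _ "- cmod (\<zeta> r)"]) (auto simp: \<zeta>_def intro: order_less_le_trans[OF _ norm_ge_zero])
  next
    case False
    then show ?thesis
      using pos[of r] \<zeta>1[of r] that
      by (intro bexI[of _ "cmod (\<zeta> r)"]) (auto simp: \<zeta>_def intro: order_less_le_trans[OF _ norm_ge_zero])
  qed
  show "\<exists>r\<in>{-1<..<1}. ?M (\<eta> r) = of_real x * q" if x: "0 \<le> x" "x < 1" for x
  proof -
    have "((\<lambda>u. cmod (\<zeta> u)) \<longlongrightarrow> 1) (at_left 1)"
      using tendsto_norm[OF lim\<zeta>] q1 by simp
    then have "\<forall>\<^sub>F u in at_left 1. x < cmod (\<zeta> u)"
      using x by (intro order_tendstoD(1)) auto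
    then have "\<forall>\<^sub>F u in at_left 1. x < cmod (\<zeta> u) \<and> 0 \<le> u \<and> u < (1::real)"
      using near1 by eventually_elim auto
    then obtain u where u: "x < cmod (\<zeta> u)" "0 \<le> u" "u < 1"
      using eventually_happens'[OF trivial_limit_at_left_real] by blast
    have nz: "1 - cnj z * \<eta> r \<noteq> 0" if "r \<in> {0..u}" for r
      using one_minus_cnj_mult_pos[of z "\<eta> r"] img[of r] that u z1 by force
    have "continuous_on {0..u} (\<lambda>r. cmod (\<zeta> r))"
      unfolding \<zeta>_def Moebius_function_simple
      using u nz by (intro continuous_intros continuous_on_subset[OF cont]) auto
    then obtain r where "0 \<le> r" "r \<le> u" "cmod (\<zeta> r) = x"
      using IVT'[of "\<lambda>r. cmod (\<zeta> r)" 0 x u] u x \<zeta>0 by auto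
    then show ?thesis
      using pos[of r] u by (intro bexI[of _ r]) (auto simp: \<zeta>_def)
  qed
qed

text \<open>A point of a Stolz region at the endpoint of the geodesic has bounded distance to it. In normalized position
  a Stolz region at \<open>p\<close> stays within a Stolz region at \<open>q\<close>, and there the point \<open>|u| q\<close> of the radius is close
  to \<open>u\<close>.\<close>

lemma hyp_dist_curve_le:
  assumes geo: "full_geodesic \<eta>" "\<eta> 0 = z" "(\<eta> \<longlongrightarrow> p) (at_left 1)"
    and z: "cmod z < 1" and p: "cmod p = 1" and w: "cmod w < 1"
    and K: "0 \<le> K" "cmod (p - w) \<le> K * (1 - (cmod w)\<^sup>2)"
  shows "hyp_dist_curve w \<eta> \<le> artanh (sqrt (1 - 1 / (2 * K / (1 - cmod z) + 1)\<^sup>2))"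
proof -
  let ?M = "Moebius_function 0 z"
  define u where "u = ?M w"
  define q where "q = ?M p"
  define K' where "K' = 2 * K / (1 - cmod z)"
  have K': "0 \<le> K'"
    using K z by (simp add: K'_def)
  have u1: "cmod u < 1"
    unfolding u_def by (rule Moebius_function_norm_lt_1[OF z w])
  have q1: "cmod q = 1"
    unfolding q_def by (rule Moebius_unit[OF z p])
  let ?x = "cmod u"
  have pos: "0 < 1 - (cmod z)\<^sup>2" "0 < 1 - (cmod w)\<^sup>2" "0 < 1 - ?x\<^sup>2"
    "0 < cmod (1 - cnj z * p)" "0 < cmod (1 - cnj z * w)"
    using one_minus_power2_pos z w u1 one_minus_cnj_mult_pos[of z] p by auto
  have zp: "1 - cmod z \<le> cmod (1 - cnj z * p)"
    using one_minus_norm_le[of p z] p by simp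
  have zw: "cmod (1 - cnj z * w) \<le> 2"
    using norm_one_minus_cnj_le_2[of z w] z w by simp
  have "cmod (1 - cnj q * u) = (1 - (cmod z)\<^sup>2) * cmod (p - w) / (cmod (1 - cnj z * p) * cmod (1 - cnj z * w))"
    unfolding q_def u_def using one_minus_cnj_Moebius[of z p w] z p w by (simp add: norm_one_minus_cnj_unit)
  also have "\<dots> \<le> (1 - (cmod z)\<^sup>2) * (K * (1 - (cmod w)\<^sup>2)) / (cmod (1 - cnj z * p) * cmod (1 - cnj z * w))"
    using pos K by (intro divide_right_mono mult_left_mono) auto
  also have "\<dots> = (1 - ?x\<^sup>2) * (K * cmod (1 - cnj z * w) / cmod (1 - cnj z * p))"
    unfolding u_def Moebius_defect[OF z w] sech2_def using pos by (simp add: power2_eq_square field_simps)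
  also have "\<dots> \<le> (1 - ?x\<^sup>2) * (K * 2 / (1 - cmod z))"
    using pos K zp zw z by (intro mult_left_mono frac_le mult_nonneg_nonneg) auto
  finally have uq: "cmod (1 - cnj q * u) \<le> K' * (1 - ?x\<^sup>2)"
    by (simp add: K'_def mult.commute)
  let ?e = "of_real ?x * q"
  have e: "cmod ?e = ?x"
    using q1 by (simp add: norm_mult)
  have "1 - cnj u * ?e = of_real ?x * (1 - cnj u * q) + of_real (1 - ?x)"
    by (simp add: algebra_simps)
  then have "cmod (1 - cnj u * ?e) \<le> cmod (of_real ?x * (1 - cnj u * q)) + cmod (of_real (1 - ?x))"
    by (metis norm_triangle_ineq)
  also have "\<dots> = ?x * cmod (1 - cnj q * u) + (1 - ?x)"
    using u1 norm_one_minus_cnj_commute[of u q] by (simp only: norm_mult norm_of_real) simp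
  also have "\<dots> \<le> 1 * cmod (1 - cnj q * u) + (1 - ?x\<^sup>2)"
    using u1 one_minus_power2_le(1)[of ?x] by (intro add_mono mult_right_mono) auto
  also have "\<dots> \<le> (K' + 1) * (1 - ?x\<^sup>2)"
    using uq by (simp add: algebra_simps)
  finally have d: "cmod (1 - cnj u * ?e) \<le> (K' + 1) * (1 - ?x\<^sup>2)" .
  have d0: "0 < cmod (1 - cnj u * ?e)"
    using one_minus_cnj_mult_pos[of u ?e] u1 e by auto
  then have "(1 - ?x\<^sup>2)\<^sup>2 / ((K' + 1) * (1 - ?x\<^sup>2))\<^sup>2 \<le> (1 - ?x\<^sup>2)\<^sup>2 / (cmod (1 - cnj u * ?e))\<^sup>2"
    using d d0 K' pos by (intro divide_left_mono power_mono mult_pos_pos zero_less_power zero_le_power2) linarith+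
  then have s: "1 / (K' + 1)\<^sup>2 \<le> sech2 u ?e"
    unfolding sech2_def e using pos by (simp add: power_mult_distrib power2_eq_square)
  obtain r where r: "r \<in> {-1<..<1}" "?M (\<eta> r) = ?e"
    using full_geodesic_normalized(3)[OF geo, of ?x] u1 by (auto simp: q_def)
  have \<eta>: "cmod (\<eta> r) < 1" if "r \<in> {-1<..<1}" for r
    using geo(1) that by (auto simp: full_geodesic_def image_subset_iff)
  have "hyp_dist_curve w \<eta> \<le> hyp_dist w (\<eta> r)"
    unfolding hyp_dist_curve_def
    using r \<eta> w hyp_dist_nonneg by (intro cINF_lower bdd_belowI2[of _ 0]) auto
  also have "\<dots> = hyp_dist u ?e"
    using hyp_dist_Moebius[OF z w \<eta>[OF r(1)]] r(2) by (simp add: u_def)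
  also have "\<dots> \<le> artanh (sqrt (1 - 1 / (K' + 1)\<^sup>2))"
    using s K' u1 e by (intro hyp_dist_le) auto
  finally show ?thesis
    by (simp add: K'_def)
qed

text \<open>Outside the horodisk at \<open>q\<close> through 0 one has \<open>1 - |u|\<^sup>2 \<le> |1 - c|\<^sup>2\<close> with \<open>c = cnj u q\<close>, which makes \<open>S\<close> small near
  \<open>q\<close> against every point of the diameter. On the far half of the diameter \<open>|1 - x c| \<ge> 1\<close>; on the near
  half \<open>|1 - x c|\<close> dominates both \<open>1 - x\<close> and \<open>|1 - c| / 2\<close>.\<close>

lemma sech2_outside_horodisk_diameter:
  assumes q: "cmod q = 1" and u: "cmod u < 1" and x: "-1 < x" "x < 1"
    and outside: "1 \<le> horocycle_level q u" and near: "cmod (1 - cnj q * u) \<le> 1"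
  shows "sech2 u (of_real x * q) \<le> 4 * cmod (1 - cnj q * u)"
proof -
  define c where "c = cnj u * q"
  define a where "a = cmod (1 - c)"
  have c: "cmod c < 1"
    using q u by (simp add: c_def norm_mult)
  have a: "a = cmod (1 - cnj q * u)"
    by (simp add: a_def c_def norm_one_minus_cnj_commute)
  define d where "d = cmod (1 - of_real x * c)"
  have d: "cmod (1 - cnj u * (of_real x * q)) = d"
    by (simp add: d_def c_def mult.left_commute)
  have xq: "cmod (of_real x * q) = \<bar>x\<bar>"
    using q by (simp add: norm_mult)
  have q2: "0 < 1 - (cmod u)\<^sup>2"
    by (rule one_minus_power2_pos[OF u])
  have ua: "1 - (cmod u)\<^sup>2 \<le> a\<^sup>2"
    using outside q2 by (simp add: horocycle_level_def a field_simps)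
  have x2: "0 \<le> 1 - x\<^sup>2" "1 - x\<^sup>2 \<le> 1"
    using x by (auto simp: abs_square_le_1 abs_le_iff)
  have S: "sech2 u (of_real x * q) = (1 - (cmod u)\<^sup>2) * (1 - x\<^sup>2) / d\<^sup>2"
    unfolding sech2_def d xq by simp
  have a0: "0 \<le> a" "a \<le> 1"
    using near by (auto simp: a)
  have "(1 - (cmod u)\<^sup>2) * (1 - x\<^sup>2) / d\<^sup>2 \<le> 4 * a"
  proof (cases "0 \<le> x")
    case True
    have "cmod (of_real x * c) \<le> x"
      using True c by (simp add: norm_mult mult_left_le)
    then have "1 - x \<le> d"
      using norm_triangle_ineq2[of 1 "of_real x * c"] by (simp add: d_def)
    then have d0: "0 < d" "1 - x\<^sup>2 \<le> 2 * d"
      using x True one_minus_power2_le(2)[of x] by auto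
    have "1 - c = (1 - of_real x * c) - of_real (1 - x) * c"
      by (simp add: algebra_simps)
    then have "a \<le> d + cmod (of_real (1 - x) * c)"
      unfolding a_def d_def by (metis norm_triangle_ineq4)
    also have "cmod (of_real (1 - x) * c) \<le> 1 - x"
      using c x by (simp only: norm_mult norm_of_real) (simp add: mult_left_le)
    finally have ad: "a \<le> 2 * d"
      using \<open>1 - x \<le> d\<close> by simp
    have "(1 - (cmod u)\<^sup>2) * (1 - x\<^sup>2) \<le> a\<^sup>2 * (2 * d)"
      using ua d0 x2 by (intro mult_mono) auto
    also have "\<dots> = (a * 2 * d) * a"
      by (simp add: power2_eq_square)
    also have "\<dots> \<le> (a * 2 * d) * (2 * d)"
      using ad a0 d0 by (intro mult_left_mono) auto
    also have "\<dots> = 4 * a * d\<^sup>2"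
      by (simp add: power2_eq_square)
    finally show ?thesis
      using d0 by (simp add: pos_divide_le_eq)
  next
    case False
    have "\<bar>Re (1 - c)\<bar> \<le> a"
      unfolding a_def by (rule abs_Re_le_cmod)
    then have "0 \<le> Re c"
      using a0 by simp
    then have "x * Re c \<le> 0"
      using False by (simp add: mult_nonpos_nonneg)
    then have "1 \<le> Re (1 - of_real x * c)"
      by simp
    also have "\<dots> \<le> d"
      unfolding d_def by (rule complex_Re_le_cmod)
    finally have "1 \<le> d" .
    then have "1 \<le> d\<^sup>2"
      by simp
    have "(1 - (cmod u)\<^sup>2) * (1 - x\<^sup>2) / d\<^sup>2 \<le> (a\<^sup>2 * 1) / 1"
      using ua x2 \<open>1 \<le> d\<^sup>2\<close> by (intro frac_le mult_mono) auto
    also have "\<dots> \<le> a"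
      using a0 by (simp add: power2_eq_square mult_left_le)
    finally show ?thesis
      using a0 by linarith
  qed
  then show ?thesis
    unfolding S a[symmetric] .
qed

text \<open>Tangential approach to the endpoint of a geodesic, in the strong sense of staying outside a horodisk, means
  infinite distance to the geodesic.\<close>

lemma hyp_dist_curve_at_top:
  assumes geo: "full_geodesic \<eta>" "\<eta> 0 = z" "(\<eta> \<longlongrightarrow> p) (at_left 1)"
    and z: "cmod z < 1" and p: "cmod p = 1"
    and f: "\<forall>\<^sub>F t in F. cmod (f t) < 1 \<and> horocycle_level p z \<le> horocycle_level p (f t)" and lim: "(f \<longlongrightarrow> p) F"
  shows "filterlim (\<lambda>t. hyp_dist_curve (f t) \<eta>) at_top F"
proof -
  let ?M = "Moebius_function 0 z"
  define q where "q = ?M p"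
  define a where "a = (\<lambda>t. cmod (1 - cnj q * ?M (f t)))"
  have q1: "cmod q = 1"
    unfolding q_def by (rule Moebius_unit[OF z p])
  have "(a \<longlongrightarrow> cmod (1 - cnj q * q)) F"
    unfolding a_def q_def Moebius_function_simple
    using one_minus_cnj_mult_pos[of z p] z p by (intro tendsto_intros lim) auto
  then have a: "(a \<longlongrightarrow> 0) F"
    by (simp add: norm_one_minus_cnj_unit[OF q1])
  then have small: "\<forall>\<^sub>F t in F. a t < 1 / 4"
    by (rule order_tendstoD) simp
  have apos: "\<forall>\<^sub>F t in F. 0 < a t"
    using f
  proof eventually_elim
    case (elim t)
    have "cmod (?M (f t)) < 1"
      using elim z by (intro Moebius_function_norm_lt_1) auto
    then show ?case
      using one_minus_cnj_mult_pos[of "?M (f t)" q] q1 by (simp add: a_def norm_one_minus_cnj_commute[of q])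
  qed
  have "\<forall>\<^sub>F t in F. artanh (sqrt (1 - 4 * a t)) \<le> hyp_dist_curve (f t) \<eta>"
    using f small
  proof eventually_elim
    case (elim t)
    have u1: "cmod (?M (f t)) < 1"
      using elim z by (intro Moebius_function_norm_lt_1) auto
    have "1 \<le> horocycle_level q (?M (f t))"
      using horocycle_level_Moebius[OF z _ p, of "f t"] horocycle_level_pos[OF p z] elim by (simp add: q_def)
    then have S: "sech2 (?M (f t)) (of_real x * q) \<le> 4 * a t" if "x \<in> {-1<..<1}" for x
      unfolding a_def using that elim u1 q1 by (intro sech2_outside_horodisk_diameter) (auto simp: a_def)
    show ?case
      unfolding hyp_dist_curve_def
    proof (rule cINF_greatest)
      fix r :: real
      assume r: "r \<in> {-1<..<1}"
      then have \<eta>: "cmod (\<eta> r) < 1"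
        using geo(1) by (auto simp: full_geodesic_def image_subset_iff)
      obtain x where x: "x \<in> {-1<..<1}" "?M (\<eta> r) = of_real x * q"
        using full_geodesic_normalized(2)[OF geo r] by (auto simp: q_def)
      have "artanh (sqrt (1 - 4 * a t)) \<le> hyp_dist (?M (f t)) (?M (\<eta> r))"
      proof (rule hyp_dist_ge)
        show "sech2 (?M (f t)) (?M (\<eta> r)) \<le> 4 * a t"
          unfolding x(2) using S x(1) by simp
        show "cmod (?M (\<eta> r)) < 1"
          by (rule Moebius_function_norm_lt_1[OF z \<eta>])
      qed (use u1 elim in auto)
      then show "artanh (sqrt (1 - 4 * a t)) \<le> hyp_dist (f t) (\<eta> r)"
        using hyp_dist_Moebius[OF z _ \<eta>] elim by simp
    qed simp
  qed
  moreover have "filterlim (\<lambda>t. artanh (sqrt (1 - 4 * a t))) at_top F"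
  proof (rule filterlim_compose[OF artanh_real_at_left_1])
    have "((\<lambda>t. sqrt (1 - 4 * a t)) \<longlongrightarrow> sqrt (1 - 4 * 0)) F"
      by (intro tendsto_intros a)
    moreover have "\<forall>\<^sub>F t in F. 0 < a t \<and> a t \<noteq> 0"
      using apos by eventually_elim simp
    ultimately show "filterlim (\<lambda>t. sqrt (1 - 4 * a t)) (at_left 1) F"
      by (simp add: filterlim_at)
  qed
  ultimately show ?thesis
    by (metis (mono_tags) filterlim_at_top_mono)
qed

section \<open>One-parameter semigroups\<close>

lemma semigroup_holomorphic: "disk_semigroup \<phi> \<Longrightarrow> 0 \<le> t \<Longrightarrow> \<phi> t holomorphic_on unit_disk"
  and semigroup_image: "disk_semigroup \<phi> \<Longrightarrow> 0 \<le> t \<Longrightarrow> \<phi> t ` unit_disk \<subseteq> unit_disk"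
  and semigroup_in_disk: "disk_semigroup \<phi> \<Longrightarrow> 0 \<le> t \<Longrightarrow> cmod z < 1 \<Longrightarrow> cmod (\<phi> t z) < 1"
  and semigroup_0: "disk_semigroup \<phi> \<Longrightarrow> cmod z < 1 \<Longrightarrow> \<phi> 0 z = z"
  and semigroup_add: "disk_semigroup \<phi> \<Longrightarrow> 0 \<le> t \<Longrightarrow> 0 \<le> s \<Longrightarrow> cmod z < 1 \<Longrightarrow> \<phi> (t + s) z = \<phi> t (\<phi> s z)"
  unfolding disk_semigroup_def by (auto simp: image_subset_iff)

lemma semigroup_Schwarz_Pick:
  assumes "disk_semigroup \<phi>" "0 \<le> t" "cmod a < 1" "cmod b < 1"
  shows "sech2 a b \<le> sech2 (\<phi> t a) (\<phi> t b)"
  using assms by (intro Schwarz_Pick semigroup_holomorphic semigroup_image)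

lemma semigroup_tendsto_0:
  assumes "disk_semigroup \<phi>" "cmod z < 1"
  shows "((\<lambda>t. \<phi> t z) \<longlongrightarrow> z) (at_right 0)"
proof -
  have "compact {z} \<and> {z} \<subseteq> unit_disk"
    using assms by simp
  then have "uniform_limit {z} \<phi> (\<lambda>z. z) (at_right 0)"
    using assms(1) unfolding disk_semigroup_def by blast
  then show ?thesis
    using tendsto_uniform_limitI by (metis singletonI)
qed

text \<open>Continuity at 0 is part of the definition, and Schwarz-Pick for \<open>\<phi> s\<close> propagates it to all times: \<open>\<phi> s z\<close> and
  \<open>\<phi> t z\<close> are no further apart than \<open>z\<close> and \<open>\<phi> (t - s) z\<close>.\<close>

lemma semigroup_continuous_orbit:
  assumes \<phi>: "disk_semigroup \<phi>" and z: "cmod z < 1"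
  shows "continuous_on {0..} (\<lambda>t. \<phi> t z)"
proof -
  have S: "((\<lambda>h. sech2 z (\<phi> h z)) \<longlongrightarrow> 1) (at_right 0)"
  proof -
    have d: "cmod (1 - cnj z * z) \<noteq> 0"
      using one_minus_cnj_mult_pos[of z z] z by auto
    have "((\<lambda>h. sech2 z (\<phi> h z)) \<longlongrightarrow> sech2 z z) (at_right 0)"
      unfolding sech2_def using d by (intro tendsto_intros semigroup_tendsto_0 \<phi> z) auto
    moreover have "sech2 z z = 1"
      using pseudo_hyperbolic_eq_sech2[OF z z] by simp
    ultimately show ?thesis by simp
  qed
  have key: "(cmod (\<phi> s z - \<phi> t z))\<^sup>2 \<le> 4 * (1 - sech2 z (\<phi> (t - s) z))" if "0 \<le> s" "s \<le> t" for s t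
  proof -
    have "\<phi> t z = \<phi> s (\<phi> (t - s) z)"
      using semigroup_add[OF \<phi>, of s "t - s" z] that z by simp
    then have "sech2 z (\<phi> (t - s) z) \<le> sech2 (\<phi> s z) (\<phi> t z)"
      using semigroup_Schwarz_Pick[OF \<phi>, of s z "\<phi> (t - s) z"]
        that z semigroup_in_disk[OF \<phi>, of "t - s" z] by simp
    moreover have "(cmod (\<phi> s z - \<phi> t z))\<^sup>2 \<le> 4 * (1 - sech2 (\<phi> s z) (\<phi> t z))"
      using that z by (intro dist_le_of_sech2 semigroup_in_disk[OF \<phi>]) auto
    ultimately show ?thesis
      by (meson diff_left_mono mult_left_mono order_trans zero_le_numeral)
  qed
  show ?thesis
    unfolding continuous_on_iff
  proof (intro ballI allI impI)
    fix t e :: real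
    assume "t \<in> {0..}" "0 < e"
    then have "\<forall>\<^sub>F h in at_right 0. 1 - e\<^sup>2 / 4 < sech2 z (\<phi> h z)"
      by (intro order_tendstoD(1)[OF S]) auto
    then obtain d where "0 < d" and d: "\<And>h. 0 < h \<Longrightarrow> h < d \<Longrightarrow> 1 - e\<^sup>2 / 4 < sech2 z (\<phi> h z)"
      unfolding eventually_at_right_field by auto
    have close: "cmod (\<phi> s z - \<phi> t z) < e" if "0 \<le> s" "s < t" "t - s < d" for s t
    proof -
      have "(cmod (\<phi> s z - \<phi> t z))\<^sup>2 < e\<^sup>2"
        using key[of s t] d[of "t - s"] that by auto
      then show ?thesis
        using \<open>0 < e\<close> by (simp add: power2_less_imp_less)
    qed
    have "dist (\<phi> t' z) (\<phi> t z) < e" if t': "t' \<in> {0..}" "dist t' t < d" for t'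
    proof (cases t' t rule: linorder_cases)
      case less
      then have "cmod (\<phi> t' z - \<phi> t z) < e"
        using t' by (intro close) (auto simp: dist_real_def)
      then show ?thesis
        by (simp add: dist_norm)
    next
      case equal
      then show ?thesis
        using \<open>0 < e\<close> by simp
    next
      case greater
      then have "cmod (\<phi> t z - \<phi> t' z) < e"
        using t' \<open>t \<in> {0..}\<close> by (intro close) (auto simp: dist_real_def)
      then show ?thesis
        by (simp add: dist_norm norm_minus_commute)
    qed
    then show "\<exists>d>0. \<forall>t'\<in>{0..}. dist t' t < d \<longrightarrow> dist (\<phi> t' z) (\<phi> t z) < e"
      using \<open>0 < d\<close> by blast
  qed
qed

text \<open>At the first time \<open>s\<close> at which two orbits meet they come close to the meeting point \<open>c\<close> shortly before, as two
  different points. But \<open>\<phi> h\<close> with small \<open>h\<close> is so close to the identity near \<open>c\<close>, including its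
  derivative, that it is injective there.\<close>

lemma semigroup_inj:
  assumes \<phi>: "disk_semigroup \<phi>" and "0 \<le> t"
  shows "inj_on (\<phi> t) unit_disk"
proof (rule inj_onI, rule ccontr)
  fix a b
  assume ab: "a \<in> unit_disk" "b \<in> unit_disk" and eq: "\<phi> t a = \<phi> t b" and "a \<noteq> b"
  define E where "E = {s \<in> {0..t}. \<phi> s a = \<phi> s b}"
  have "compact E"
  proof -
    have "continuous_on {0..t} (\<lambda>s. \<phi> s a - \<phi> s b)"
      using ab by (intro continuous_on_diff continuous_on_subset[OF semigroup_continuous_orbit[OF \<phi>]]) auto
    then have "closed ({0..t} \<inter> (\<lambda>s. \<phi> s a - \<phi> s b) -` {0})"
      by (intro continuous_closed_preimage) auto
    moreover have "E = {0..t} \<inter> (\<lambda>s. \<phi> s a - \<phi> s b) -` {0}"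
      by (auto simp: E_def)
    ultimately show ?thesis
      by (metis compact_Int_closed[OF compact_Icc] inf.left_idem)
  qed
  moreover have "t \<in> E"
    using eq \<open>0 \<le> t\<close> by (simp add: E_def)
  ultimately obtain s where s: "s \<in> E" and least: "\<And>r. r \<in> E \<Longrightarrow> s \<le> r"
    using compact_attains_inf[of E] by auto
  define c where "c = \<phi> s a"
  have s0: "0 < s"
    using s ab \<open>a \<noteq> b\<close> semigroup_0[OF \<phi>] by (cases "s = 0") (auto simp: E_def)
  have c: "cmod c < 1"
    using s ab semigroup_in_disk[OF \<phi>] by (auto simp: c_def E_def)
  define r where "r = (1 - cmod c) / 2"
  have r: "0 < r" "cball c r \<subseteq> unit_disk"
  proof -
    show "0 < r" using c by (simp add: r_def)
    show "cball c r \<subseteq> unit_disk"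
    proof
      fix x assume "x \<in> cball c r"
      then show "x \<in> unit_disk"
        using norm_triangle_ineq2[of x c] c by (auto simp: r_def dist_norm norm_minus_commute)
    qed
  qed
  have "uniform_limit (cball c r) \<phi> (\<lambda>z. z) (at_right 0)"
    using \<phi> r by (auto simp: disk_semigroup_def)
  then have "\<forall>\<^sub>F h in at_right 0. \<forall>x\<in>cball c r. dist (\<phi> h x) x < r / 4"
    using r by (intro uniform_limitD) auto
  then obtain d where "0 < d" and d: "\<And>h x. 0 < h \<Longrightarrow> h < d \<Longrightarrow> x \<in> cball c r \<Longrightarrow> dist (\<phi> h x) x < r / 4"
    unfolding eventually_at_right_field by auto
  have near: "\<exists>\<delta>>0. \<forall>u\<in>{0..}. \<bar>u - s\<bar> < \<delta> \<longrightarrow> dist (\<phi> u x) c < r / 4" if "x = a \<or> x = b" for x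
  proof -
    have "continuous_on {0..} (\<lambda>t. \<phi> t x)" "\<phi> s x = c"
      using that ab s semigroup_continuous_orbit[OF \<phi>] by (auto simp: c_def E_def)
    moreover have "s \<in> {0..}" "0 < r / 4" using s0 r by auto
    ultimately show ?thesis
      unfolding continuous_on_iff dist_real_def by blast
  qed
  obtain da where da: "0 < da" "\<And>u. 0 \<le> u \<Longrightarrow> \<bar>u - s\<bar> < da \<Longrightarrow> dist (\<phi> u a) c < r / 4"
    using near[of a] by auto
  obtain db where db: "0 < db" "\<And>u. 0 \<le> u \<Longrightarrow> \<bar>u - s\<bar> < db \<Longrightarrow> dist (\<phi> u b) c < r / 4"
    using near[of b] by auto
  \<comment> \<open>So small that \<open>h\<close> is an admissible time, \<open>\<phi> h\<close> is \<open>r / 4\<close>-close to the identity on \<open>cball c r\<close>, and both orbits are \<open>r / 4\<close>-close to \<open>c\<close> at time \<open>s - h\<close>.\<close>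
  define h where "h = min (min (d / 2) (s / 2)) (min (da / 2) (db / 2))"
  have h: "0 < h" "h < d" "h < s" "h < da" "h < db"
    using \<open>0 < d\<close> s0 da(1) db(1) by (auto simp: h_def)
  define u v where "u = \<phi> (s - h) a" and "v = \<phi> (s - h) b"
  have uv: "dist u c < r / 4" "dist v c < r / 4"
    unfolding u_def v_def using h by (intro da(2) db(2); simp)+
  have "\<phi> h u = c" "\<phi> h v = c"
    using semigroup_add[OF \<phi>, of h "s - h"] h ab s by (auto simp: u_def v_def c_def E_def)
  moreover have "u \<noteq> v"
  proof
    assume "u = v"
    then have "s - h \<in> E"
      using h s by (auto simp: E_def u_def v_def)
    then show False
      using least h by fastforce
  qed
  moreover have "\<phi> h u \<noteq> \<phi> h v" if "u \<noteq> v"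
  proof -
    define g where "g = (\<lambda>x. \<phi> h x - x)"
    have hol: "g holomorphic_on ball c r" 
      unfolding g_def using semigroup_holomorphic[OF \<phi>, of h] h r ball_subset_cball[of c r]
      by (intro holomorphic_intros) (blast intro: holomorphic_on_subset less_imp_le)
    have gb: "cmod (g x) \<le> r / 4" if "x \<in> cball c r" for x
      using d[of h x] h that by (auto simp: g_def dist_norm)
    \<comment> \<open>Cauchy estimate on disks of radius \<open>r / 2\<close>: \<open>(r / 4) / (r / 2) = 1 / 2\<close>.\<close>
    have deriv: "cmod (deriv g x) \<le> 1 / 2" if "x \<in> cball c (r / 4)" for x
    proof -
      have sub: "cball x (r / 2) \<subseteq> ball c r"
        using that r(1) by (simp add: cball_subset_ball_iff dist_commute)
      have "cmod ((deriv ^^ 1) g x) \<le> fact 1 * (r / 4) / (r / 2) ^ 1"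
      proof (rule Cauchy_inequality)
        show "g holomorphic_on ball x (r / 2)"
          using hol sub ball_subset_cball holomorphic_on_subset by blast
        show "continuous_on (cball x (r / 2)) g"
          using hol sub holomorphic_on_imp_continuous_on holomorphic_on_subset by blast
        fix y assume "cmod (x - y) = r / 2"
        then have "y \<in> cball x (r / 2)"
          by (simp add: dist_norm)
        then show "cmod (g y) \<le> r / 4"
          using gb sub by (meson ball_subset_cball subsetD)
      qed (use r in auto)
      then show ?thesis
        using r by simp
    qed
    have "cmod (g u - g v) \<le> 1 / 2 * cmod (u - v)"
    proof (rule field_differentiable_bound[of "cball c (r / 4)"])
      fix x assume x: "x \<in> cball c (r / 4)"
      then have "x \<in> ball c r" using r(1) by auto
      then have "(g has_field_derivative deriv g x) (at x)"
        using hol holomorphic_derivI open_ball by blast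
      then show "(g has_field_derivative deriv g x) (at x within cball c (r / 4))"
        by (rule has_field_derivative_at_within)
    qed (use deriv uv in \<open>auto simp: dist_commute\<close>)
    then have "cmod (g u - g v) < cmod (u - v)"
    proof (rule order_le_less_trans)
      show "1 / 2 * cmod (u - v) < cmod (u - v)"
        using that by simp
    qed
    then show ?thesis
      by (auto simp: g_def norm_minus_commute)
  qed
  ultimately show False
    by simp
qed

lemma Denjoy_Wolff_unique:
  assumes "Denjoy_Wolff_point \<phi> \<tau>" "Denjoy_Wolff_point \<phi> \<tau>'"
  shows "\<tau> = \<tau>'"
proof -
  have "((\<lambda>t. \<phi> t 0) \<longlongrightarrow> \<tau>) at_top" "((\<lambda>t. \<phi> t 0) \<longlongrightarrow> \<tau>') at_top"
    using assms by (auto simp: Denjoy_Wolff_point_def)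
  then show ?thesis
    using tendsto_unique trivial_limit_at_top_linorder by blast
qed

lemma frequently_nonincreasing:
  fixes d :: "nat \<Rightarrow> real"
  assumes d: "\<And>n. 0 < d n" and lim: "d \<longlonglongrightarrow> 0"
  shows "\<exists>\<^sub>F n in sequentially. d (Suc n) \<le> d n"
proof (rule ccontr)
  assume "\<not> ?thesis"
  then obtain N where N: "\<And>n. N \<le> n \<Longrightarrow> d n < d (Suc n)"
    by (auto simp: not_frequently eventually_sequentially not_le)
  have "d N \<le> d n" if "N \<le> n" for n
    using that by (induction n rule: dec_induct) (use N in \<open>auto intro: order_trans less_imp_le\<close>)
  then have "d N \<le> 0"
    by (intro LIMSEQ_le_const[OF lim]) auto
  then show False
    using d[of N] by simp
qed

text \<open>Along a forward orbit \<open>1 - |\<cdot>|\<^sup>2\<close> tends to 0, hence it does not increase at infinitely many steps, and these steps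
  provide the ratio required by Julia's lemma.\<close>

lemma Wolff_horocycle:
  assumes \<phi>: "disk_semigroup \<phi>" and DW: "Denjoy_Wolff_point \<phi> \<tau>" and \<tau>: "cmod \<tau> = 1"
    and "0 \<le> t" "cmod x < 1"
  shows "horocycle_level \<tau> (\<phi> t x) \<le> horocycle_level \<tau> x"
proof (cases "t = 0")
  case True
  then show ?thesis
    using assms semigroup_0[OF \<phi>, of x] by simp
next
  case False
  then have t: "0 < t" using \<open>0 \<le> t\<close> by simp
  define a where "a = (\<lambda>n. \<phi> (real n * t) 0)"
  have a1: "cmod (a n) < 1" for n
    unfolding a_def using semigroup_in_disk[OF \<phi>] t by simp
  have fa: "\<phi> t (a n) = a (Suc n)" for n
    using semigroup_add[OF \<phi>, of t "real n * t" 0] t by (simp add: a_def algebra_simps)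
  have "filterlim (\<lambda>n. real n * t) at_top sequentially"
    using t by (intro filterlim_at_top_mult_tendsto_pos[OF tendsto_const] filterlim_real_sequentially)
  then have a: "a \<longlonglongrightarrow> \<tau>"
    unfolding a_def using DW by (auto simp: Denjoy_Wolff_point_def intro: filterlim_compose)
  define d where "d = (\<lambda>n. 1 - (cmod (a n))\<^sup>2)"
  have d: "0 < d n" for n
    using a1 one_minus_power2_pos by (simp add: d_def)
  have "d \<longlonglongrightarrow> 1 - (cmod \<tau>)\<^sup>2"
    unfolding d_def by (intro tendsto_intros a)
  then have "\<exists>\<^sub>F n in sequentially. d (Suc n) \<le> d n"
    using \<tau> by (intro frequently_nonincreasing d) simp
  then have ratio: "\<exists>\<^sub>F n in sequentially. 1 - (cmod (\<phi> t (a n)))\<^sup>2 \<le> r * (1 - (cmod (a n))\<^sup>2)" if "1 < r" for r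
  proof (rule frequently_elim1)
    fix n assume "d (Suc n) \<le> d n"
    also have "d n \<le> r * d n"
      using d[of n] that by simp
    finally show "1 - (cmod (\<phi> t (a n)))\<^sup>2 \<le> r * (1 - (cmod (a n))\<^sup>2)"
      by (simp add: d_def fa)
  qed
  show ?thesis
    by (rule Julia_horocycle[of _ a, OF semigroup_holomorphic[OF \<phi>] semigroup_image[OF \<phi>]])
       (use assms a1 a fa ratio LIMSEQ_Suc[OF a] in auto)
qed

section \<open>Petals and the inverse flow\<close>

lemma backward_invariant_subset_disk:
  assumes \<phi>: "disk_semigroup \<phi>"
  shows "backward_invariant_set \<phi> \<subseteq> unit_disk"
proof -
  have "backward_invariant_set \<phi> \<subseteq> \<phi> 0 ` unit_disk"
    by (auto simp: backward_invariant_set_def)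
  then show ?thesis
    using semigroup_image[OF \<phi>, of 0] by auto
qed

lemma semigroup_backward_invariant:
  assumes \<phi>: "disk_semigroup \<phi>" and t: "0 \<le> t" and w: "w \<in> backward_invariant_set \<phi>"
  shows "\<phi> t w \<in> backward_invariant_set \<phi>"
  unfolding backward_invariant_set_def
proof
  fix s :: real
  assume "s \<in> {0..}"
  then have s: "0 \<le> s" by simp
  have w1: "cmod w < 1"
    using backward_invariant_subset_disk[OF \<phi>] w by auto
  show "\<phi> t w \<in> \<phi> s ` unit_disk"
  proof (cases "s \<le> t")
    case True
    then have "\<phi> t w = \<phi> s (\<phi> (t - s) w)"
      using semigroup_add[OF \<phi>, of s "t - s" w] s w1 by simp
    then show ?thesis
      using semigroup_in_disk[OF \<phi>, of "t - s" w] True w1 by auto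
  next
    case False
    then have "s - t \<in> {0..}"
      by simp
    then have "w \<in> \<phi> (s - t) ` unit_disk"
      using w unfolding backward_invariant_set_def by blast
    then obtain x where x: "cmod x < 1" "w = \<phi> (s - t) x"
      by auto
    then have "\<phi> t w = \<phi> s x"
      using semigroup_add[OF \<phi>, of t "s - t" x] t False by simp
    then show ?thesis
      using x by auto
  qed
qed

text \<open>By injectivity, a preimage of a point that has arbitrarily long backward orbits has such orbits itself.\<close>

lemma backward_invariant_if_image:
  assumes \<phi>: "disk_semigroup \<phi>" and t: "0 \<le> t" and w: "cmod w < 1"
    and tw: "\<phi> t w \<in> backward_invariant_set \<phi>"
  shows "w \<in> backward_invariant_set \<phi>"
  unfolding backward_invariant_set_def
proof
  fix s :: real
  assume "s \<in> {0..}"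
  then have s: "0 \<le> s" by simp
  then obtain x where x: "cmod x < 1" "\<phi> t w = \<phi> (t + s) x"
    using tw t by (force simp: backward_invariant_set_def)
  then have "\<phi> t w = \<phi> t (\<phi> s x)"
    using semigroup_add[OF \<phi> t s] by simp
  then have "w = \<phi> s x"
    using semigroup_inj[OF \<phi> t] w semigroup_in_disk[OF \<phi> s x(1)] by (auto dest: inj_onD)
  then show "w \<in> \<phi> s ` unit_disk"
    using x by auto
qed

lemma petal_open: "petal \<phi> \<Delta> \<Longrightarrow> open \<Delta>"
  unfolding petal_def by (rule open_components[OF open_interior])

lemma petal_subset: "petal \<phi> \<Delta> \<Longrightarrow> \<Delta> \<subseteq> interior (backward_invariant_set \<phi>)"
  unfolding petal_def by (rule in_components_subset)

lemma petal_subset_disk: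
  assumes "disk_semigroup \<phi>" "petal \<phi> \<Delta>"
  shows "\<Delta> \<subseteq> unit_disk"
  using petal_subset[OF assms(2)] interior_subset backward_invariant_subset_disk[OF assms(1)] by blast

text \<open>Both \<open>\<phi> t\<close> and its inverse map the interior of the backward invariant set into itself, hence components into components.
  It is the same component because the orbit of a point of \<open>\<Delta>\<close> is a path that does not leave this interior.\<close>

lemma petal_image:
  assumes \<phi>: "disk_semigroup \<phi>" and \<Delta>: "petal \<phi> \<Delta>" and t: "0 \<le> t"
  shows "\<phi> t ` \<Delta> = \<Delta>"
proof -
  let ?W = "backward_invariant_set \<phi>"
  have \<Delta>C: "\<Delta> \<in> components (interior ?W)"
    using \<Delta> by (simp add: petal_def)
  have sub: "\<Delta> \<subseteq> unit_disk"
    by (rule petal_subset_disk[OF \<phi> \<Delta>])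
  have conn: "connected \<Delta>" and ne: "\<Delta> \<noteq> {}"
    using \<Delta>C in_components_connected in_components_nonempty by auto
  have Wsub: "interior ?W \<subseteq> unit_disk"
    using backward_invariant_subset_disk[OF \<phi>] interior_subset by blast
  have inv: "\<phi> s ` interior ?W \<subseteq> interior ?W" if "0 \<le> s" for s
  proof (rule interior_maximal)
    show "\<phi> s ` interior ?W \<subseteq> ?W"
      using semigroup_backward_invariant[OF \<phi> that] interior_subset by blast
    show "open (\<phi> s ` interior ?W)"
      using semigroup_holomorphic[OF \<phi> that] semigroup_inj[OF \<phi> that] Wsub
      by (intro open_mapping_thm3 open_interior) (auto intro: holomorphic_on_subset inj_on_subset)
  qed
  obtain z where z: "z \<in> \<Delta>"
    using ne by auto
  then have z1: "cmod z < 1"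
    using sub by auto
  have tz: "\<phi> t z \<in> \<Delta>"
  proof -
    let ?P = "(\<lambda>s. \<phi> s z) ` {0..t}"
    have "?P \<subseteq> \<Delta>"
    proof (rule components_maximal[OF \<Delta>C])
      show "connected ?P"
        by (intro connected_continuous_image continuous_on_subset[OF semigroup_continuous_orbit[OF \<phi> z1]]) auto
      show "?P \<subseteq> interior ?W"
        using inv z petal_subset[OF \<Delta>] by force
      have "\<phi> 0 z \<in> ?P"
        using t by auto
      then show "\<Delta> \<inter> ?P \<noteq> {}"
        using semigroup_0[OF \<phi> z1] z by auto
    qed
    then show ?thesis
      using t by auto
  qed
  show ?thesis
  proof
    show "\<phi> t ` \<Delta> \<subseteq> \<Delta>"
    proof (rule components_maximal[OF \<Delta>C])
      show "connected (\<phi> t ` \<Delta>)"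
        using semigroup_holomorphic[OF \<phi> t] sub conn
        by (meson connected_continuous_image continuous_on_subset holomorphic_on_imp_continuous_on)
      show "\<phi> t ` \<Delta> \<subseteq> interior ?W"
        using inv[OF t] petal_subset[OF \<Delta>] by blast
      show "\<Delta> \<inter> \<phi> t ` \<Delta> \<noteq> {}"
        using tz z by auto
    qed
    obtain g where g: "g holomorphic_on (\<phi> t ` unit_disk)" "\<And>w. w \<in> unit_disk \<Longrightarrow> g (\<phi> t w) = w"
      using holomorphic_has_inverse[OF semigroup_holomorphic[OF \<phi> t] open_ball semigroup_inj[OF \<phi> t]] by metis
    have \<Delta>im: "\<Delta> \<subseteq> \<phi> t ` unit_disk"
    proof -
      have "\<Delta> \<subseteq> ?W"
        using petal_subset[OF \<Delta>] interior_subset by blast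
      then show ?thesis
        using t by (auto simp: backward_invariant_set_def)
    qed
    have gW: "g ` \<Delta> \<subseteq> ?W"
    proof
      fix v assume "v \<in> g ` \<Delta>"
      then obtain w where w: "w \<in> \<Delta>" "v = g w" by auto
      then obtain x where x: "x \<in> unit_disk" "w = \<phi> t x"
        using \<Delta>im by auto
      then have "v = x" using w g by auto
      moreover have "w \<in> ?W"
        using w petal_subset[OF \<Delta>] interior_subset by blast
      ultimately show "v \<in> ?W"
        using backward_invariant_if_image[OF \<phi> t, of x] x by simp
    qed
    have \<phi>g: "\<phi> t (g w) = w" if w: "w \<in> \<Delta>" for w
    proof -
      obtain x where "x \<in> unit_disk" "w = \<phi> t x"
        using \<Delta>im w by blast
      then show ?thesis
        by (simp only: g(2))
    qed
    then have gi: "inj_on g \<Delta>"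
      by (rule inj_on_inverseI)
    have "g ` \<Delta> \<subseteq> \<Delta>"
    proof (rule components_maximal[OF \<Delta>C])
      have hol: "g holomorphic_on \<Delta>"
        using g(1) \<Delta>im holomorphic_on_subset by blast
      then show "connected (g ` \<Delta>)"
        using conn connected_continuous_image holomorphic_on_imp_continuous_on by blast
      have "open (g ` \<Delta>)"
        by (rule open_mapping_thm3[OF hol petal_open[OF \<Delta>] gi])
      then show "g ` \<Delta> \<subseteq> interior ?W"
        using gW interior_maximal by blast
      have "g (\<phi> t z) = z"
        using g(2) z1 by auto
      then show "\<Delta> \<inter> g ` \<Delta> \<noteq> {}"
        using z tz by force
    qed
    then show "\<Delta> \<subseteq> \<phi> t ` \<Delta>"
      using \<phi>g by (metis image_eqI image_subset_iff subsetI)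
  qed
qed

lemma backward_orbit_in_petal:
  assumes \<phi>: "disk_semigroup \<phi>" and \<Delta>: "petal \<phi> \<Delta>" and t: "0 \<le> t" and z: "z \<in> \<Delta>"
  shows "backward_orbit \<phi> \<Delta> z (- t) \<in> \<Delta>"
    and "\<phi> t (backward_orbit \<phi> \<Delta> z (- t)) = z"
proof -
  have z': "z \<in> \<phi> t ` \<Delta>"
    using petal_image[OF \<phi> \<Delta> t] z by simp
  show "backward_orbit \<phi> \<Delta> z (- t) \<in> \<Delta>" "\<phi> t (backward_orbit \<phi> \<Delta> z (- t)) = z"
    using inv_into_into[OF z'] f_inv_into_f[OF z'] by (simp_all add: backward_orbit_def)
qed

lemma backward_orbit_eqI:
  assumes \<phi>: "disk_semigroup \<phi>" and \<Delta>: "petal \<phi> \<Delta>" and t: "0 \<le> t" and w: "w \<in> \<Delta>" "\<phi> t w = z"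
  shows "backward_orbit \<phi> \<Delta> z (- t) = w"
proof -
  have "inj_on (\<phi> t) \<Delta>"
    using semigroup_inj[OF \<phi> t] petal_subset_disk[OF \<phi> \<Delta>] inj_on_subset by blast
  then show ?thesis
    using w by (auto simp: backward_orbit_def)
qed

lemma backward_orbit_add:
  assumes \<phi>: "disk_semigroup \<phi>" and \<Delta>: "petal \<phi> \<Delta>" and st: "0 \<le> s" "0 \<le> t" and z: "z \<in> \<Delta>"
  shows "\<phi> s (backward_orbit \<phi> \<Delta> z (- (s + t))) = backward_orbit \<phi> \<Delta> z (- t)"
proof -
  let ?b = "backward_orbit \<phi> \<Delta> z (- (s + t))"
  have b: "?b \<in> \<Delta>" "\<phi> (s + t) ?b = z"
    using backward_orbit_in_petal[OF \<phi> \<Delta> _ z, of "s + t"] st by auto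
  have "\<phi> s ?b \<in> \<Delta>"
    using petal_image[OF \<phi> \<Delta> st(1)] b by auto
  moreover have "\<phi> t (\<phi> s ?b) = z"
    using semigroup_add[OF \<phi> st(2,1), of ?b] b petal_subset_disk[OF \<phi> \<Delta>] by (auto simp: add.commute)
  ultimately show ?thesis
    using backward_orbit_eqI[OF \<phi> \<Delta> st(2)] by simp
qed

lemma backward_flow_holomorphic:
  assumes \<phi>: "disk_semigroup \<phi>" and \<Delta>: "petal \<phi> \<Delta>" and t: "0 \<le> t"
  shows "(\<lambda>w. backward_orbit \<phi> \<Delta> w (- t)) holomorphic_on \<Delta>"
proof -
  have hol: "\<phi> t holomorphic_on \<Delta>" and inj: "inj_on (\<phi> t) \<Delta>"
    using semigroup_holomorphic[OF \<phi> t] semigroup_inj[OF \<phi> t] petal_subset_disk[OF \<phi> \<Delta>]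
    by (auto intro: holomorphic_on_subset inj_on_subset)
  obtain g where g: "g holomorphic_on (\<phi> t ` \<Delta>)" "\<And>w. w \<in> \<Delta> \<Longrightarrow> g (\<phi> t w) = w"
    using holomorphic_has_inverse[OF hol petal_open[OF \<Delta>] inj] by metis
  have "g w = backward_orbit \<phi> \<Delta> w (- t)" if "w \<in> \<Delta>" for w
    using backward_orbit_in_petal[OF \<phi> \<Delta> t that] g(2) by metis
  then show ?thesis
    using g(1) unfolding petal_image[OF \<phi> \<Delta> t] by (rule holomorphic_transform[rotated])
qed

text \<open>On the half-plane \<open>H = k ` \<Delta>\<close> the coordinate change \<open>f = h \<circ> k\<^sup>-\<^sup>1\<close> commutes with all translations to the
  right, so its derivative is 1 and it is a translation. It cannot map a half-plane onto a strip.\<close>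

lemma strip_half_plane_exclusive:
  assumes \<phi>: "disk_semigroup \<phi>" and \<Delta>: "petal \<phi> \<Delta>"
    and h: "Koenigs_function \<phi> h" and k: "Koenigs_function \<phi> k"
    and strip: "horizontal_strip (h ` \<Delta>)" and half: "horizontal_half_plane (k ` \<Delta>)"
  shows False
proof -
  have hhol: "h holomorphic_on unit_disk" and khol: "k holomorphic_on unit_disk" and kinj: "inj_on k unit_disk"
    and h\<phi>: "\<And>z t. cmod z < 1 \<Longrightarrow> 0 \<le> t \<Longrightarrow> h (\<phi> t z) = h z + of_real t"
    and k\<phi>: "\<And>z t. cmod z < 1 \<Longrightarrow> 0 \<le> t \<Longrightarrow> k (\<phi> t z) = k z + of_real t"
    using h k by (auto simp: Koenigs_function_def)
  have sub: "\<Delta> \<subseteq> unit_disk"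
    by (rule petal_subset_disk[OF \<phi> \<Delta>])
  define H where "H = k ` \<Delta>"
  obtain g where g: "g holomorphic_on H" "\<And>w. w \<in> \<Delta> \<Longrightarrow> g (k w) = w"
    unfolding H_def using holomorphic_has_inverse[of k \<Delta>] petal_open[OF \<Delta>] khol kinj sub
    by (metis holomorphic_on_subset inj_on_subset)
  obtain a where a: "H = {w. a < Im w} \<or> H = {w. Im w < a}"
    using half by (auto simp: horizontal_half_plane_def H_def)
  have H: "convex H" "open H"
    using a by (auto simp: convex_halfspace_Im_gt convex_halfspace_Im_lt open_halfspace_Im_gt open_halfspace_Im_lt)
  define f where "f = (\<lambda>w. h (g w))"
  have ghol: "f holomorphic_on H"
  proof -
    have "h \<circ> g holomorphic_on H"
      by (rule holomorphic_on_compose_gen[OF g(1) hhol]) (use g(2) sub in \<open>auto simp: H_def\<close>)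
    then show ?thesis
      by (simp add: f_def o_def)
  qed
  have ft: "f (w + of_real t) = f w + of_real t" if w: "w \<in> H" and t: "0 \<le> t" for w t
  proof -
    obtain x where x: "x \<in> \<Delta>" "w = k x"
      using w by (auto simp: H_def)
    have x1: "cmod x < 1"
      using x sub by auto
    have "\<phi> t x \<in> \<Delta>"
      using petal_image[OF \<phi> \<Delta> t] x by auto
    then have "g (k x + of_real t) = \<phi> t x"
      using g(2) k\<phi>[OF x1 t] by metis
    then show ?thesis
      using h\<phi>[OF x1 t] g(2) x by (simp add: f_def)
  qed
  have deriv: "(f has_field_derivative 1) (at w)" if w: "w \<in> H" for w
  proof -
    obtain D where D: "(f has_field_derivative D) (at w)"
      using ghol H(2) w holomorphic_on_imp_differentiable_at field_differentiable_def by blast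
    define s where "s = (\<lambda>n. of_real (inverse (real (Suc n))) :: complex)"
    have nz: "s n \<noteq> 0" for n
      unfolding s_def of_real_eq_0_iff by simp
    have "s \<longlonglongrightarrow> of_real 0"
      unfolding s_def by (intro tendsto_of_real LIMSEQ_inverse_real_of_nat)
    then have s: "filterlim s (at 0) sequentially"
      unfolding filterlim_at using nz by simp
    have "(\<lambda>n. (f (w + s n) - f w) / s n) \<longlonglongrightarrow> D"
      using D unfolding DERIV_def by (rule filterlim_compose[OF _ s])
    moreover have "(f (w + s n) - f w) / s n = 1" for n
    proof -
      have "f (w + s n) = f w + s n"
        unfolding s_def by (rule ft[OF w]) simp
      then show ?thesis
        using nz[of n] by simp
    qed
    ultimately have "(\<lambda>n. 1) \<longlonglongrightarrow> D"
      by (simp only:)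
    then have "D = 1"
      using LIMSEQ_unique tendsto_const by blast
    then show ?thesis
      using D by simp
  qed
  have "\<exists>c. \<forall>w\<in>H. f w - w = c"
  proof (rule has_field_derivative_zero_constant[OF H(1)])
    fix w assume "w \<in> H"
    then have "((\<lambda>w. f w - w) has_field_derivative (1 - 1)) (at w within H)"
      by (intro derivative_intros has_field_derivative_at_within[OF deriv])
    then show "((\<lambda>w. f w - w) has_field_derivative 0) (at w within H)"
      by simp
  qed
  then obtain c where c: "\<And>w. w \<in> H \<Longrightarrow> f w = w + c"
    by (metis add.commute diff_add_cancel)
  obtain b1 b2 where b: "h ` \<Delta> = {w. b1 < Im w \<and> Im w < b2}"
    using strip by (auto simp: horizontal_strip_def)
  have fH: "b1 < Im w + Im c" "Im w + Im c < b2" if w: "w \<in> H" for w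
  proof -
    have "f w \<in> h ` \<Delta>"
      using w g(2) by (auto simp: H_def f_def)
    then show "b1 < Im w + Im c" "Im w + Im c < b2"
      using b c[OF w] by auto
  qed
  show False
    using a
  proof
    assume "H = {w. a < Im w}"
    then have "Complex 0 (max (a + 1) (b2 - Im c)) \<in> H"
      by auto
    then show False
      using fH(2) by fastforce
  next
    assume "H = {w. Im w < a}"
    then have "Complex 0 (min (a - 1) (b1 - Im c)) \<in> H"
      by auto
    then show False
      using fH(1) by fastforce
  qed
qed

lemma hyperbolic_not_parabolic:
  assumes \<phi>: "disk_semigroup \<phi>" and hyp: "hyperbolic_petal \<phi> \<Delta>" and par: "parabolic_petal \<phi> \<Delta>"
  shows False
proof -
  have \<Delta>: "petal \<phi> \<Delta>"
    using hyp by (simp add: hyperbolic_petal_def)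
  obtain \<tau> k where \<tau>: "cmod \<tau> = 1" "Denjoy_Wolff_point \<phi> \<tau>"
    and k: "Koenigs_function \<phi> k" "horizontal_half_plane (k ` \<Delta>)"
    using par by (auto simp: parabolic_petal_def non_elliptic_def maximal_subset_def)
  have "\<not> elliptic \<phi>"
    using Denjoy_Wolff_unique[OF \<tau>(2)] \<tau>(1) by (auto simp: elliptic_def)
  then obtain h where "Koenigs_function \<phi> h" "horizontal_strip (h ` \<Delta>)"
    using hyp by (auto simp: hyperbolic_petal_def maximal_subset_def)
  then show False
    using strip_half_plane_exclusive[OF \<phi> \<Delta> _ k(1) _ k(2)] by blast
qed

section \<open>Backward orbits in hyperbolic petals\<close>

text \<open>If no such \<open>r\<close> existed, Julia's lemma along \<open>w\<close> would give \<open>horocycle_level p (\<phi> n x) \<le> horocycle_level p x\<close> for all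
  \<open>n\<close>. Letting first \<open>n\<close> tend to infinity and then \<open>x\<close> tend to \<open>p\<close> radially yields \<open>p = \<tau>\<close>, wherever \<open>\<tau>\<close> lies in the
  closed disk.\<close>

lemma backward_sequence_ratio:
  assumes \<phi>: "disk_semigroup \<phi>" and DW: "Denjoy_Wolff_point \<phi> \<tau>"
    and p: "cmod p = 1" "p \<noteq> \<tau>"
    and w: "\<And>n::nat. cmod (w n) < 1" "\<And>n. \<phi> 1 (w (Suc n)) = w n" "w \<longlonglongrightarrow> p"
  shows "\<exists>r>1. \<forall>\<^sub>F n in sequentially. r * (1 - (cmod (w (Suc n)))\<^sup>2) \<le> 1 - (cmod (w n))\<^sup>2"
proof (rule ccontr)
  assume contra: "\<not> ?thesis"
  have ratio: "\<exists>\<^sub>F n in sequentially. 1 - (cmod (\<phi> 1 (w (Suc n))))\<^sup>2 \<le> r * (1 - (cmod (w (Suc n)))\<^sup>2)" if "1 < r" for r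
  proof -
    have "\<exists>\<^sub>F n in sequentially. \<not> r * (1 - (cmod (w (Suc n)))\<^sup>2) \<le> 1 - (cmod (w n))\<^sup>2"
      using contra that by (auto simp: frequently_def)
    then show ?thesis
      by (rule frequently_elim1) (simp add: w(2))
  qed
  have step: "horocycle_level p (\<phi> 1 x) \<le> horocycle_level p x" if "cmod x < 1" for x
    by (rule Julia_horocycle[of _ "\<lambda>n. w (Suc n)", OF semigroup_holomorphic[OF \<phi>] semigroup_image[OF \<phi>]])
       (use that w ratio LIMSEQ_Suc[OF w(3)] in auto)
  have iter: "horocycle_level p (\<phi> (real n) x) \<le> horocycle_level p x" if "cmod x < 1" for x n
  proof (induction n)
    case 0
    then show ?case using semigroup_0[OF \<phi> that] by simp
  next
    case (Suc n)
    have "\<phi> (real (Suc n)) x = \<phi> 1 (\<phi> (real n) x)"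
      using semigroup_add[OF \<phi>, of 1 "real n" x] that by simp
    then show ?case
      using step[of "\<phi> (real n) x"] semigroup_in_disk[OF \<phi>, of "real n" x] that Suc by simp
  qed
  have lim: "(cmod (1 - cnj p * \<tau>))\<^sup>2 * (1 - (cmod x)\<^sup>2) \<le> (1 - (cmod \<tau>)\<^sup>2) * (cmod (1 - cnj p * x))\<^sup>2"
    if x: "cmod x < 1" for x
  proof (rule LIMSEQ_le)
    have L: "(\<lambda>n. \<phi> (real n) x) \<longlonglongrightarrow> \<tau>"
      using DW x by (auto simp: Denjoy_Wolff_point_def intro!: filterlim_compose[OF _ filterlim_real_sequentially])
    show "(\<lambda>n. (cmod (1 - cnj p * \<phi> (real n) x))\<^sup>2 * (1 - (cmod x)\<^sup>2)) \<longlonglongrightarrow> (cmod (1 - cnj p * \<tau>))\<^sup>2 * (1 - (cmod x)\<^sup>2)"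
      by (intro tendsto_intros L)
    show "(\<lambda>n. (1 - (cmod (\<phi> (real n) x))\<^sup>2) * (cmod (1 - cnj p * x))\<^sup>2) \<longlonglongrightarrow> (1 - (cmod \<tau>)\<^sup>2) * (cmod (1 - cnj p * x))\<^sup>2"
      by (intro tendsto_intros L)
    have "(cmod (1 - cnj p * \<phi> (real n) x))\<^sup>2 * (1 - (cmod x)\<^sup>2) \<le> (1 - (cmod (\<phi> (real n) x))\<^sup>2) * (cmod (1 - cnj p * x))\<^sup>2" for n
      using iter[OF x, of n] one_minus_power2_pos[OF x] one_minus_power2_pos[OF semigroup_in_disk[OF \<phi> _ x], of "real n"]
      by (simp add: horocycle_level_def field_simps)
    then show "\<exists>N. \<forall>n\<ge>N. (cmod (1 - cnj p * \<phi> (real n) x))\<^sup>2 * (1 - (cmod x)\<^sup>2) \<le> (1 - (cmod (\<phi> (real n) x))\<^sup>2) * (cmod (1 - cnj p * x))\<^sup>2"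
      by blast
  qed
  have "(cmod (1 - cnj p * \<tau>))\<^sup>2 \<le> 0 + e" if "0 < e" for e
  proof -
    \<comment> \<open>The test point \<open>s p\<close> on the radius to \<open>p\<close>, for which \<open>1 - s \<le> e\<close>.\<close>
    define s where "s = 1 - min e 1"
    have s: "0 \<le> s" "s < 1" "1 - s \<le> e"
      using that by (auto simp: s_def)
    have ps: "cnj p * (of_real s * p) = of_real s"
      using p complex_norm_square[of p] by (simp add: mult.left_commute mult.commute)
    have "cmod (of_real s * p) = s" "1 - cnj p * (of_real s * p) = of_real (1 - s)"
      using s p unfolding ps by (auto simp: norm_mult)
    then have "(cmod (1 - cnj p * \<tau>))\<^sup>2 * (1 - s\<^sup>2) \<le> (1 - (cmod \<tau>)\<^sup>2) * (1 - s)\<^sup>2"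
      using lim[of "of_real s * p"] s by (simp only: norm_of_real abs_of_nonneg power2_abs)
    also have "\<dots> \<le> 1 * (1 - s)\<^sup>2"
      by (intro mult_right_mono) auto
    finally have "((cmod (1 - cnj p * \<tau>))\<^sup>2 * (1 + s)) * (1 - s) \<le> (1 - s) * (1 - s)"
      by (simp add: power2_eq_square algebra_simps)
    then have "(cmod (1 - cnj p * \<tau>))\<^sup>2 * (1 + s) \<le> 1 - s"
      using s by simp
    moreover have "(cmod (1 - cnj p * \<tau>))\<^sup>2 * 1 \<le> (cmod (1 - cnj p * \<tau>))\<^sup>2 * (1 + s)"
      using s by (intro mult_left_mono) auto
    ultimately show ?thesis
      using s by linarith
  qed
  then have "(cmod (1 - cnj p * \<tau>))\<^sup>2 \<le> 0"
    by (rule field_le_epsilon)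
  then have "p = \<tau>"
    by (simp add: norm_one_minus_cnj_unit[OF p(1)])
  then show False
    using p by simp
qed

text \<open>The ratio condition bounds each step by a multiple of the decrease of \<open>1 - |w n|\<^sup>2\<close>, so the steps telescope.\<close>

lemma nontangential_of_geometric_approach:
  assumes w: "w \<longlonglongrightarrow> p" "\<And>n::nat. cmod (w n) < 1"
    and C: "0 \<le> C" "\<And>n. cmod (w n - w (Suc n)) \<le> C * (1 - (cmod (w (Suc n)))\<^sup>2)"
    and r: "1 < r" "\<forall>\<^sub>F n in sequentially. r * (1 - (cmod (w (Suc n)))\<^sup>2) \<le> 1 - (cmod (w n))\<^sup>2"
  shows "\<exists>K\<ge>0. \<forall>\<^sub>F n in sequentially. cmod (p - w n) \<le> K * (1 - (cmod (w n))\<^sup>2)"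
proof -
  define q where "q = (\<lambda>n. 1 - (cmod (w n))\<^sup>2)"
  have q: "0 < q n" for n
    using w one_minus_power2_pos by (simp add: q_def)
  \<comment> \<open>Since \<open>(r - 1) q (n+1) \<le> q n - q (n+1)\<close>, this \<open>K\<close> gives steps of size at most \<open>K (q n - q (n+1))\<close>.\<close>
  define K where "K = C / (r - 1)"
  have K: "0 \<le> K"
    using C r by (simp add: K_def)
  obtain N where N: "\<And>n. N \<le> n \<Longrightarrow> r * q (Suc n) \<le> q n"
    using r(2) by (auto simp: q_def eventually_sequentially)
  have step: "cmod (w n - w (Suc n)) \<le> K * (q n - q (Suc n))" if "N \<le> n" for n
  proof -
    have "cmod (w n - w (Suc n)) \<le> C * q (Suc n)"
      using C by (simp add: q_def)
    also have "\<dots> = K * ((r - 1) * q (Suc n))"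
      using r by (simp add: K_def)
    also have "\<dots> \<le> K * (q n - q (Suc n))"
      using N[OF that] K by (intro mult_left_mono) (auto simp: algebra_simps)
    finally show ?thesis .
  qed
  have tele: "cmod (w m - w n) \<le> K * (q n - q m)" if "N \<le> n" "n \<le> m" for n m
    using that(2)
  proof (induction m rule: dec_induct)
    case (step m)
    have "cmod (w (Suc m) - w n) \<le> cmod (w (Suc m) - w m) + cmod (w m - w n)"
      using norm_triangle_ineq[of "w (Suc m) - w m" "w m - w n"] by simp
    then show ?case
      using step assms that \<open>\<And>n. N \<le> n \<Longrightarrow> cmod (w n - w (Suc n)) \<le> K * (q n - q (Suc n))\<close>[of m]
      by (simp add: norm_minus_commute algebra_simps)
  qed simp
  have "cmod (p - w n) \<le> K * q n" if "N \<le> n" for n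
  proof (rule LIMSEQ_le_const2)
    show "(\<lambda>m. cmod (w m - w n)) \<longlonglongrightarrow> cmod (p - w n)"
      by (intro tendsto_intros w)
    have "cmod (w m - w n) \<le> K * q n" if "n \<le> m" for m
    proof -
      have "K * (q n - q m) \<le> K * q n"
        using K q[of m] by (intro mult_left_mono) auto
      then show ?thesis
        using tele[OF \<open>N \<le> n\<close> that] by linarith
    qed
    then show "\<exists>M. \<forall>m\<ge>M. cmod (w m - w n) \<le> K * q n"
      by blast
  qed
  then show ?thesis
    using K by (auto simp: eventually_sequentially q_def)
qed

text \<open>Integer times are covered by the two preceding lemmas; the times in between stay at bounded hyperbolic
  distance from them. Both kinds of bounded distance come from one path, the orbit from the point at time \<open>-1\<close>
  to \<open>z\<close>, carried along by the inverse flow.\<close>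

lemma hyperbolic_petal_nontangential:
  assumes \<phi>: "disk_semigroup \<phi>" and \<Delta>: "petal \<phi> \<Delta>" and z: "z \<in> \<Delta>"
    and DW: "Denjoy_Wolff_point \<phi> \<tau>" and p: "cmod p = 1" "p \<noteq> \<tau>"
    and lim: "(backward_orbit \<phi> \<Delta> z \<longlongrightarrow> p) at_bot"
  shows "\<exists>K\<ge>0. \<forall>\<^sub>F t in at_bot. cmod (p - backward_orbit \<phi> \<Delta> z t) \<le> K * (1 - (cmod (backward_orbit \<phi> \<Delta> z t))\<^sup>2)"
proof -
  define b where "b = (\<lambda>t. backward_orbit \<phi> \<Delta> z (- t))"
  have b\<Delta>: "b t \<in> \<Delta>" if "0 \<le> t" for t
    unfolding b_def by (rule backward_orbit_in_petal(1)[OF \<phi> \<Delta> that z])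
  then have b1: "cmod (b t) < 1" if "0 \<le> t" for t
    using petal_subset_disk[OF \<phi> \<Delta>] that by force
  have b0: "b 0 = z"
    unfolding b_def using semigroup_0[OF \<phi>, of z] petal_subset_disk[OF \<phi> \<Delta>] z
    by (intro backward_orbit_eqI[OF \<phi> \<Delta>]) auto
  have badd: "\<phi> s (b (s + t)) = b t" if "0 \<le> s" "0 \<le> t" for s t
    unfolding b_def by (rule backward_orbit_add[OF \<phi> \<Delta> that z])
  have blim: "((\<lambda>t. b t) \<longlongrightarrow> p) at_top"
    unfolding b_def using lim by (rule filterlim_compose[OF _ filterlim_uminus_at_bot_at_top])
  define w where "w = (\<lambda>n. b (real n))"
  have w: "\<And>n. cmod (w n) < 1" "\<And>n. \<phi> 1 (w (Suc n)) = w n" "w \<longlonglongrightarrow> p"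
    using b1 badd[of 1 "real _"] filterlim_compose[OF blim filterlim_real_sequentially]
    by (simp_all add: w_def)
  \<comment> \<open>The inverse flow for time \<open>n\<close> maps \<open>\<gamma>\<close> to the backward orbit between the times \<open>-(n+1)\<close> and \<open>-n\<close>.\<close>
  define \<gamma> where "\<gamma> = (\<lambda>s. \<phi> s (b 1))"
  have \<gamma>\<Delta>: "\<gamma> ` {0..1} \<subseteq> \<Delta>"
    using petal_image[OF \<phi> \<Delta>] b\<Delta>[of 1] by (force simp: \<gamma>_def)
  have \<gamma>c: "continuous_on {0..1} \<gamma>"
    unfolding \<gamma>_def using b1[of 1] by (intro continuous_on_subset[OF semigroup_continuous_orbit[OF \<phi>]]) auto
  obtain k where k: "0 < k" and kf: "\<And>f s. f holomorphic_on \<Delta> \<Longrightarrow> f ` \<Delta> \<subseteq> unit_disk \<Longrightarrow> s \<in> {0..1} \<Longrightarrow>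
      k \<le> sech2 (f (\<gamma> 0)) (f (\<gamma> s))"
    using sech2_along_path[OF petal_open[OF \<Delta>] \<gamma>c \<gamma>\<Delta>] by blast
  have \<gamma>b: "backward_orbit \<phi> \<Delta> (\<gamma> s) (- real n) = b (real (Suc n) - s)" if s: "s \<in> {0..1}" for s n
  proof (rule backward_orbit_eqI[OF \<phi> \<Delta>])
    have "\<gamma> s = b (1 - s)"
      using badd[of s "1 - s"] s by (simp add: \<gamma>_def)
    then show "\<phi> (real n) (b (real (Suc n) - s)) = \<gamma> s"
      using badd[of "real n" "1 - s"] s by (simp add: algebra_simps)
  qed (use b\<Delta> s in auto)
  have step: "k \<le> sech2 (w (Suc n)) (b (real (Suc n) - s))" if s: "s \<in> {0..1}" for s n
  proof -
    let ?f = "\<lambda>w. backward_orbit \<phi> \<Delta> w (- real n)"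
    have "k \<le> sech2 (?f (\<gamma> 0)) (?f (\<gamma> s))"
    proof (rule kf[OF backward_flow_holomorphic[OF \<phi> \<Delta>] _ s])
      show "?f ` \<Delta> \<subseteq> unit_disk"
        using backward_orbit_in_petal(1)[OF \<phi> \<Delta>, of "real n"] petal_subset_disk[OF \<phi> \<Delta>] by auto
    qed simp
    then show ?thesis
      using \<gamma>b[of 0 n] \<gamma>b[OF s, of n] by (simp add: w_def)
  qed
  obtain r where r: "1 < r" "\<forall>\<^sub>F n in sequentially. r * (1 - (cmod (w (Suc n)))\<^sup>2) \<le> 1 - (cmod (w n))\<^sup>2"
    using backward_sequence_ratio[of \<phi> \<tau> p w, OF \<phi> DW p w] by blast
  have "cmod (w n - w (Suc n)) \<le> 2 / k * (1 - (cmod (w (Suc n)))\<^sup>2)" for n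
    using sech2_compare(3)[OF w(1)[of "Suc n"] w(1)[of n] k] step[of 1 n] by (simp add: w_def norm_minus_commute)
  then obtain K where K: "0 \<le> K" "\<forall>\<^sub>F n in sequentially. cmod (p - w n) \<le> K * (1 - (cmod (w n))\<^sup>2)"
    using nontangential_of_geometric_approach[OF w(3) w(1) _ _ r, of "2 / k"] k by auto
  then obtain N where N: "\<And>n. N \<le> n \<Longrightarrow> cmod (p - w n) \<le> K * (1 - (cmod (w n))\<^sup>2)"
    by (auto simp: eventually_sequentially)
  define K' where "K' = K * (4 / k) + 2 / k"
  have "cmod (p - b t) \<le> K' * (1 - (cmod (b t))\<^sup>2)" if t: "real (Suc N) \<le> t" for t
  proof -
    \<comment> \<open>Each \<open>t\<close> lies in one of the intervals from \<open>n\<close> to \<open>n + 1\<close>.\<close>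
    define n where "n = nat \<lceil>t\<rceil> - 1"
    have "real (Suc N) \<le> real_of_int \<lceil>t\<rceil>"
      using t by linarith
    then have n: "real (Suc n) = real_of_int \<lceil>t\<rceil>" "N \<le> Suc n"
      by (simp_all add: n_def)
    define s where "s = real (Suc n) - t"
    have s: "s \<in> {0..1}" "t = real (Suc n) - s"
      using n(1) by (auto simp: s_def) linarith+
    have bt: "cmod (b t) < 1"
      using b1 t by simp
    have S: "k \<le> sech2 (b t) (w (Suc n))"
      using step[OF s(1), of n] s(2) by (simp add: sech2_commute)
    have "cmod (p - b t) \<le> cmod (p - w (Suc n)) + cmod (b t - w (Suc n))"
      using norm_triangle_ineq4[of "p - w (Suc n)" "b t - w (Suc n)"] by simp
    also have "cmod (p - w (Suc n)) \<le> K * (1 - (cmod (w (Suc n)))\<^sup>2)"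
      by (rule N[OF n(2)])
    also have "\<dots> \<le> K * (4 / k * (1 - (cmod (b t))\<^sup>2))"
      using K(1) by (intro mult_left_mono sech2_compare(2)[OF bt w(1) k S])
    also have "cmod (b t - w (Suc n)) \<le> 2 / k * (1 - (cmod (b t))\<^sup>2)"
      by (rule sech2_compare(3)[OF bt w(1) k S])
    finally show ?thesis
      by (simp add: K'_def algebra_simps)
  qed
  then have "\<forall>\<^sub>F t in at_bot. cmod (p - b (- t)) \<le> K' * (1 - (cmod (b (- t)))\<^sup>2)"
    unfolding eventually_at_bot_linorder by (intro exI[of _ "- real (Suc N)"]) auto
  moreover have "0 \<le> K'"
    using K k by (simp add: K'_def)
  ultimately show ?thesis
    by (auto simp: b_def)
qed

section \<open>Backward orbits in parabolic petals\<close>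

text \<open>By Liouville's theorem the image of \<open>h\<close> omits some \<open>c\<close>, and since it is invariant under translations to the
  right it omits the whole half-line to the left of \<open>c\<close>.\<close>

lemma Koenigs_image_subset_slit:
  assumes \<phi>: "disk_semigroup \<phi>" and h: "Koenigs_function \<phi> h"
  shows "\<exists>c. \<forall>z. cmod z < 1 \<longrightarrow> h z - c \<notin> \<real>\<^sub>\<le>\<^sub>0"
proof -
  have hol: "h holomorphic_on unit_disk" and inj: "inj_on h unit_disk"
    and hk: "\<And>z t. cmod z < 1 \<Longrightarrow> 0 \<le> t \<Longrightarrow> h (\<phi> t z) = h z + of_real t"
    using h by (auto simp: Koenigs_function_def)
  have "h ` unit_disk \<noteq> UNIV"
  proof
    assume UNIV: "h ` unit_disk = UNIV"
    obtain g where g: "g holomorphic_on UNIV" "\<And>w. w \<in> unit_disk \<Longrightarrow> g (h w) = w"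
      using holomorphic_has_inverse[OF hol open_ball inj] unfolding UNIV by metis
    have "bounded (range g)"
      unfolding UNIV[symmetric] image_image using g(2) by (auto simp: bounded_iff intro!: exI[of _ 1])
    then obtain c where "\<And>w. g w = c"
      using Liouville_theorem[OF g(1)] by (auto simp: constant_on_def)
    then have "(1 / 2 :: complex) = 0"
      using g(2)[of "1 / 2"] g(2)[of 0] by simp
    then show False
      by simp
  qed
  then obtain c where c: "c \<notin> h ` unit_disk"
    by auto
  have "h z - c \<notin> \<real>\<^sub>\<le>\<^sub>0" if z: "cmod z < 1" for z
  proof
    assume "h z - c \<in> \<real>\<^sub>\<le>\<^sub>0"
    then obtain r where "h z - c = of_real r" "r \<le> 0"
      by (auto simp: nonpos_Reals_def)
    then have "c = h (\<phi> (- r) z)"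
      using hk[OF z, of "- r"] by (simp add: algebra_simps)
    then show False
      using c semigroup_in_disk[OF \<phi>, of "- r" z] \<open>r \<le> 0\<close> z by auto
  qed
  then show ?thesis
    by blast
qed

lemma tendsto_if_dist_power2_le:
  fixes f g :: "'a \<Rightarrow> complex"
  assumes g: "(g \<longlongrightarrow> l) F" and le: "\<forall>\<^sub>F x in F. (cmod (f x - g x))\<^sup>2 \<le> e x" and e: "(e \<longlongrightarrow> 0) F"
  shows "(f \<longlongrightarrow> l) F"
proof -
  have "((\<lambda>x. (cmod (f x - g x))\<^sup>2) \<longlongrightarrow> 0) F"
    by (rule tendsto_sandwich[OF _ le tendsto_const e]) auto
  then have "((\<lambda>x. sqrt ((cmod (f x - g x))\<^sup>2)) \<longlongrightarrow> sqrt 0) F"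
    by (rule tendsto_real_sqrt)
  then have "((\<lambda>x. f x - g x) \<longlongrightarrow> 0) F"
    by (simp add: tendsto_norm_zero_iff)
  then show ?thesis
    using tendsto_add[OF _ g, of "\<lambda>x. f x - g x" 0] by simp
qed

text \<open>With \<open>R \<ge> 0\<close>, write \<open>A R\<close> for the backward orbit at time \<open>-R\<close>, let \<open>B R\<close> lie over the point of the half-plane reached from
  \<open>h z\<close> by moving \<open>R\<close> away from the boundary, and let \<open>B' R\<close> be \<open>\<phi> R (B R)\<close>. It is shown that \<open>B' R\<close> has the same limit as
  \<open>\<phi> R z\<close>, and \<open>A R\<close> the same limit as \<open>B' R\<close>.\<close>

lemma parabolic_backward_orbit_tendsto:
  assumes \<phi>: "disk_semigroup \<phi>" and \<Delta>: "petal \<phi> \<Delta>" and z: "z \<in> \<Delta>"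
    and DW: "Denjoy_Wolff_point \<phi> \<tau>" and \<tau>: "cmod \<tau> = 1"
    and h: "Koenigs_function \<phi> h" and half: "horizontal_half_plane (h ` \<Delta>)"
  shows "(backward_orbit \<phi> \<Delta> z \<longlongrightarrow> \<tau>) at_bot"
proof -
  have hol: "h holomorphic_on unit_disk" and inj: "inj_on h unit_disk"
    and hk: "\<And>z t. cmod z < 1 \<Longrightarrow> 0 \<le> t \<Longrightarrow> h (\<phi> t z) = h z + of_real t"
    using h by (auto simp: Koenigs_function_def)
  have \<Delta>1: "cmod w < 1" if "w \<in> \<Delta>" for w
    using petal_subset_disk[OF \<phi> \<Delta>] that by auto
  have z1: "cmod z < 1"
    using \<Delta>1 z by simp
  obtain \<epsilon> a :: real where \<epsilon>: "\<epsilon> = 1 \<or> \<epsilon> = - 1" and H: "h ` \<Delta> = {w. 0 < \<epsilon> * (Im w - a)}"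
  proof -
    from half obtain a where "h ` \<Delta> = {w. a < Im w} \<or> h ` \<Delta> = {w. Im w < a}"
      by (auto simp: horizontal_half_plane_def)
    then show ?thesis
      by (elim disjE) (rule that[of 1 a], simp_all, rule that[of "-1" a], simp_all)
  qed
  have \<epsilon>2: "\<epsilon> * \<epsilon> = 1"
    using \<epsilon> by auto
  obtain g where g: "g holomorphic_on (h ` \<Delta>)" "\<And>w. w \<in> \<Delta> \<Longrightarrow> g (h w) = w"
    using holomorphic_has_inverse[of h \<Delta>] petal_open[OF \<Delta>] hol inj petal_subset_disk[OF \<phi> \<Delta>]
    by (metis holomorphic_on_subset inj_on_subset)
  \<comment> \<open>The right half-plane as a parameter domain of the petal; \<open>\<epsilon>\<close> tells upper from lower half-planes. A translation by \<open>t\<close> in the Koenigs coordinate becomes \<open>s \<mapsto> s - \<i> \<epsilon> t\<close>.\<close>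
  define aff where "aff = (\<lambda>s. \<i> * (of_real a + of_real \<epsilon> * s))"
  have affH: "aff s \<in> h ` \<Delta>" if "0 < Re s" for s
    unfolding H using that \<epsilon>2 by (simp add: aff_def mult.assoc[symmetric])
  define G where "G = (\<lambda>s. g (aff s))"
  have G\<Delta>: "G s \<in> \<Delta>" and hG: "h (G s) = aff s" if "0 < Re s" for s
    using affH[OF that] g(2) by (auto simp: G_def)
  have GI: "w = G s" if "w \<in> \<Delta>" "h w = aff s" for w s
    using that g(2) by (metis G_def)
  have Ghol: "G holomorphic_on {s. 0 < Re s}"
  proof -
    have "aff holomorphic_on {s. 0 < Re s}"
      unfolding aff_def by (intro holomorphic_intros)
    then have "g \<circ> aff holomorphic_on {s. 0 < Re s}"
      by (rule holomorphic_on_compose_gen[OF _ g(1)]) (use affH in auto)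
    then show ?thesis
      by (simp add: G_def o_def)
  qed
  have G1: "cmod (G s) < 1" if "0 < Re s" for s
    using \<Delta>1 G\<Delta> that by simp
  have SP: "4 * Re s * Re t / (cmod (cnj s + t))\<^sup>2 \<le> sech2 (G s) (G t)" if "0 < Re s" "0 < Re t" for s t
    using Schwarz_Pick_right_half_plane[OF Ghol _ that] G1 by (simp add: image_subset_iff)
  have G\<phi>: "\<phi> t (G s) = G (s - \<i> * of_real (\<epsilon> * t))" if "0 < Re s" "0 \<le> t" for s t
  proof (rule GI)
    show "\<phi> t (G s) \<in> \<Delta>"
      using petal_image[OF \<phi> \<Delta> that(2)] G\<Delta>[OF that(1)] by auto
    have "\<i> * of_real \<epsilon> * (\<i> * of_real (\<epsilon> * t)) = - complex_of_real t"
      using \<epsilon> by auto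
    then show "h (\<phi> t (G s)) = aff (s - \<i> * of_real (\<epsilon> * t))"
      using hk[OF G1[OF that(1)] that(2)] hG[OF that(1)] by (simp add: aff_def algebra_simps)
  qed
  define s0 where "s0 = of_real \<epsilon> * (- \<i> * h z - of_real a)"
  define y where "y = Re s0"
  have y: "0 < y"
    using z H by (auto simp: y_def s0_def)
  have "aff s0 = h z"
    using \<epsilon> by (auto simp: aff_def s0_def algebra_simps)
  then have Gs0: "G s0 = z"
    using GI[OF z, of s0] by simp
  define A where "A = (\<lambda>R. G (s0 + \<i> * of_real (\<epsilon> * R)))"
  define B where "B = (\<lambda>R. G (s0 + of_real R))"
  define B' where "B' = (\<lambda>R. G (s0 + of_real R - \<i> * of_real (\<epsilon> * R)))"
  have AB1: "cmod (A R) < 1" "cmod (B R) < 1" "cmod (B' R) < 1" if "0 \<le> R" for R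
    using y that by (auto simp: A_def B_def B'_def y_def intro!: G1)
  have orbit: "backward_orbit \<phi> \<Delta> z (- R) = A R" if "0 \<le> R" for R
  proof (rule backward_orbit_eqI[OF \<phi> \<Delta> that])
    show "A R \<in> \<Delta>"
      unfolding A_def using y by (intro G\<Delta>) (simp add: y_def)
    show "\<phi> R (A R) = z"
      using G\<phi>[of "s0 + \<i> * of_real (\<epsilon> * R)" R] y that Gs0 by (simp add: A_def y_def)
  qed
  \<comment> \<open>Schwarz-Pick gives \<open>S(z, B R) \<le> S(\<phi> R z, B' R)\<close>, where \<open>B R\<close> and \<open>B' R\<close> are at bounded distance. So \<open>|1 - cnj (\<phi> R z) (B' R)|\<^sup>2\<close> is at most a multiple of \<open>1 - |\<phi> R z|\<^sup>2\<close>.\<close>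
  have lim\<phi>: "((\<lambda>R. \<phi> R z) \<longlongrightarrow> \<tau>) at_top"
    using DW z1 by (auto simp: Denjoy_Wolff_point_def)
  have limB': "(B' \<longlongrightarrow> \<tau>) at_top"
  proof (rule tendsto_if_dist_power2_le[OF lim\<phi>])
    define e where "e = (\<lambda>R. 20 / (1 - (cmod z)\<^sup>2) * (1 - (cmod (\<phi> R z))\<^sup>2))"
    have "(e \<longlongrightarrow> 20 / (1 - (cmod z)\<^sup>2) * (1 - (cmod \<tau>)\<^sup>2)) at_top"
      unfolding e_def by (intro tendsto_intros lim\<phi>)
    then show "(e \<longlongrightarrow> 0) at_top"
      using \<tau> by simp
    show "\<forall>\<^sub>F R in at_top. (cmod (B' R - \<phi> R z))\<^sup>2 \<le> e R"
      using eventually_ge_at_top[of 0]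
    proof eventually_elim
      case (elim R)
      note AB = AB1[OF elim]
      have \<phi>R: "cmod (\<phi> R z) < 1"
        by (rule semigroup_in_disk[OF \<phi> elim z1])
      have BB': "\<phi> R (B R) = B' R"
        using G\<phi>[of "s0 + of_real R" R] y elim by (simp add: B_def B'_def y_def)
      have "4 / 5 \<le> 4 * (y + R) * (y + R) / (cmod (cnj (s0 + of_real R) + (s0 + of_real R - \<i> * of_real (\<epsilon> * R))))\<^sup>2"
      proof -
        have "(cmod (cnj (s0 + of_real R) + (s0 + of_real R - \<i> * of_real (\<epsilon> * R))))\<^sup>2
            = 4 * (y + R)\<^sup>2 + R\<^sup>2"
          unfolding cmod_power2 using \<epsilon> by (auto simp: y_def power2_eq_square algebra_simps)
        also have "\<dots> \<le> 5 * (y + R)\<^sup>2"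
          using y elim power_mono[of R "y + R" 2] by simp
        finally have "(cmod (cnj (s0 + of_real R) + (s0 + of_real R - \<i> * of_real (\<epsilon> * R))))\<^sup>2 \<le> 5 * (y + R)\<^sup>2" .
        moreover have "0 < (cmod (cnj (s0 + of_real R) + (s0 + of_real R - \<i> * of_real (\<epsilon> * R))))\<^sup>2"
          using y elim by (auto simp: complex_eq_iff y_def)
        ultimately have bound: "4 * (y + R) * (y + R) / (5 * (y + R)\<^sup>2)
            \<le> 4 * (y + R) * (y + R) / (cmod (cnj (s0 + of_real R) + (s0 + of_real R - \<i> * of_real (\<epsilon> * R))))\<^sup>2"
          using y elim by (intro frac_le) auto
        have "4 * x * x / (5 * x\<^sup>2) = 4 / 5" if "x \<noteq> 0" for x :: real
          using that by (simp add: power2_eq_square)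
        then have "4 * (y + R) * (y + R) / (5 * (y + R)\<^sup>2) = 4 / 5"
          by this (use y elim in simp)
        then show ?thesis
          using bound by (simp only:)
      qed
      also have "\<dots> \<le> sech2 (B R) (B' R)"
        using SP[of "s0 + of_real R" "s0 + of_real R - \<i> * of_real (\<epsilon> * R)"] y elim
        by (simp add: B_def B'_def y_def)
      finally have B'B: "1 - (cmod (B' R))\<^sup>2 \<le> 5 * (1 - (cmod (B R))\<^sup>2)"
        using sech2_compare(2)[OF AB(2,3), of "4 / 5"] by simp
      let ?d = "(cmod (1 - cnj (\<phi> R z) * B' R))\<^sup>2"
      have d: "0 < ?d"
        using one_minus_cnj_mult_pos[OF \<phi>R, of "B' R"] AB by auto
      have q: "0 < 1 - (cmod (B R))\<^sup>2" "0 < 1 - (cmod z)\<^sup>2" "0 < 1 - (cmod (\<phi> R z))\<^sup>2"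
        using one_minus_power2_pos AB z1 \<phi>R by auto
      have "(1 - (cmod z)\<^sup>2) * (1 - (cmod (B R))\<^sup>2) / 4 \<le> sech2 (\<phi> R z) (B' R)"
        using sech2_ge_defect[OF z1 AB(2)] semigroup_Schwarz_Pick[OF \<phi> elim z1 AB(2)] BB' by simp
      then have "(1 - (cmod z)\<^sup>2) * (1 - (cmod (B R))\<^sup>2) / 4 * ?d \<le> (1 - (cmod (\<phi> R z))\<^sup>2) * (1 - (cmod (B' R))\<^sup>2)"
        unfolding sech2_def using d by (simp add: pos_le_divide_eq)
      also have "\<dots> \<le> (1 - (cmod (\<phi> R z))\<^sup>2) * (5 * (1 - (cmod (B R))\<^sup>2))"
        using B'B q by (intro mult_left_mono) auto
      finally have "(1 - (cmod (B R))\<^sup>2) * ((1 - (cmod z)\<^sup>2) / 4 * ?d) \<le> (1 - (cmod (B R))\<^sup>2) * (5 * (1 - (cmod (\<phi> R z))\<^sup>2))"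
        by (simp only: mult_ac times_divide_eq_left times_divide_eq_right)
      then have "(1 - (cmod z)\<^sup>2) / 4 * ?d \<le> 5 * (1 - (cmod (\<phi> R z))\<^sup>2)"
        using q by simp
      then have "?d \<le> e R"
        using q by (simp add: e_def field_simps)
      moreover have "(cmod (B' R - \<phi> R z))\<^sup>2 \<le> ?d"
        unfolding norm_one_minus_cnj_mult using q one_minus_power2_pos[OF AB(3)]
        by (simp add: norm_minus_commute less_imp_le)
      ultimately show ?case
        by linarith
    qed
  qed
  \<comment> \<open>Comparison with the slit plane, which the map \<open>F\<close> takes into the disk, bounds \<open>1 - |A R|\<^sup>2\<close>.\<close>
  obtain c where c: "\<And>w. cmod w < 1 \<Longrightarrow> h w - c \<notin> \<real>\<^sub>\<le>\<^sub>0"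
    using Koenigs_image_subset_slit[OF \<phi> h] by blast
  define F where "F = (\<lambda>w. cayley (csqrt (h w - c)))"
  have Re_csqrt_pos: "0 < Re (csqrt (h w - c))" if "cmod w < 1" for w
  proof -
    have "Re (csqrt (h w - c)) \<noteq> 0"
    proof
      assume "Re (csqrt (h w - c)) = 0"
      then have "(csqrt (h w - c))\<^sup>2 = of_real (- (Im (csqrt (h w - c)))\<^sup>2)"
        by (simp add: complex_eq_iff Re_power2 Im_power2 del: power2_csqrt csqrt.simps)
      then have "h w - c = of_real (- (Im (csqrt (h w - c)))\<^sup>2)"
        by (simp only: power2_csqrt)
      then have "h w - c \<in> \<real>\<^sub>\<le>\<^sub>0"
        by (metis nonpos_Reals_of_real_iff neg_le_0_iff_le zero_le_power2)
      then show False
        using c[OF that] by simp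
    qed
    then show ?thesis
      using Re_csqrt[of "h w - c"] by linarith
  qed
  have F: "F holomorphic_on unit_disk" "F ` unit_disk \<subseteq> unit_disk"
  proof -
    have "csqrt (h w - c) + 1 \<noteq> 0" if "w \<in> unit_disk" for w
      using Re_pos_add_1_neq_0[OF Re_csqrt_pos] that by auto
    then show "F holomorphic_on unit_disk"
      unfolding F_def cayley_def using c by (intro holomorphic_intros hol) auto
    show "F ` unit_disk \<subseteq> unit_disk"
      using cayley_in_disk[OF Re_csqrt_pos] by (auto simp: F_def)
  qed
  obtain C where C: "0 < C" "\<And>w. cmod w < 1 \<Longrightarrow> 1 - (cmod w)\<^sup>2 \<le> C * (1 - (cmod (F w))\<^sup>2)"
    using Schwarz_Pick_defect[OF F z1] by blast
  define m where "m = cmod (h z - c)"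
  have m: "0 \<le> m"
    by (simp add: m_def)
  define D where "D = C * (2 * m) * (13 / (4 * y)) * 2"
  have "(A \<longlongrightarrow> \<tau>) at_top"
  proof (rule tendsto_if_dist_power2_le[OF limB'])
    have "filterlim (\<lambda>R. sqrt (R - m)) at_top at_top"
    proof (rule filterlim_compose[OF sqrt_at_top])
      show "filterlim (\<lambda>R. R - m) at_top at_top"
        using filterlim_tendsto_add_at_top[OF tendsto_const[of "- m"] filterlim_ident] by simp
    qed
    then show "((\<lambda>R. D / sqrt (R - m)) \<longlongrightarrow> 0) at_top"
      by (intro tendsto_divide_0[OF tendsto_const] filterlim_at_top_imp_at_infinity)
    show "\<forall>\<^sub>F R in at_top. (cmod (A R - B' R))\<^sup>2 \<le> D / sqrt (R - m)"
      \<comment> \<open>For such \<open>R\<close> both \<open>y \<le> R\<close> and \<open>R \<le> 2 (R - m)\<close>.\<close>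
      using eventually_ge_at_top[of "2 * m + y"]
    proof eventually_elim
      case (elim R)
      have R: "0 < R" "y \<le> R" "m < R" "R \<le> 2 * (R - m)"
        using elim y m by auto
      note AB = AB1[OF less_imp_le[OF R(1)]]
      let ?d = "(cmod (1 - cnj (A R) * B' R))\<^sup>2"
      have d: "0 < ?d"
        using one_minus_cnj_mult_pos[OF AB(1), of "B' R"] AB by auto
      have q: "0 < 1 - (cmod (A R))\<^sup>2" "0 < 1 - (cmod (B' R))\<^sup>2"
        using one_minus_power2_pos AB by auto
      have "4 * y / 13 / R \<le> 4 * y * (y + R) / (cmod (cnj (s0 + \<i> * of_real (\<epsilon> * R)) + (s0 + of_real R - \<i> * of_real (\<epsilon> * R))))\<^sup>2"
      proof -
        let ?n = "(cmod (cnj (s0 + \<i> * of_real (\<epsilon> * R)) + (s0 + of_real R - \<i> * of_real (\<epsilon> * R))))\<^sup>2"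
        have "?n = (2 * y + R)\<^sup>2 + 4 * R\<^sup>2"
          unfolding cmod_power2 using \<epsilon> by (auto simp: y_def power2_eq_square algebra_simps)
        also have "(2 * y + R)\<^sup>2 \<le> (3 * R)\<^sup>2"
          using R y by (intro power_mono) auto
        finally have n: "?n \<le> 13 * R\<^sup>2"
          by (simp add: power_mult_distrib)
        have "0 < ?n"
          using y R by (auto simp: complex_eq_iff y_def)
        then have "4 * y * R / (13 * R\<^sup>2) \<le> 4 * y * (y + R) / ?n"
          using n y R by (intro frac_le mult_left_mono) auto
        then show ?thesis
          using R by (simp add: power2_eq_square)
      qed
      also have "\<dots> \<le> sech2 (A R) (B' R)"
        using SP[of "s0 + \<i> * of_real (\<epsilon> * R)" "s0 + of_real R - \<i> * of_real (\<epsilon> * R)"] y R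
        by (simp add: A_def B'_def y_def)
      finally have "4 * y / 13 / R * ?d \<le> (1 - (cmod (A R))\<^sup>2) * (1 - (cmod (B' R))\<^sup>2)"
        unfolding sech2_def using d by (simp only: pos_le_divide_eq)
      also have "\<dots> \<le> (1 - (cmod (A R))\<^sup>2) * 1"
        using q by (intro mult_left_mono) auto
      finally have d_le: "?d \<le> (1 - (cmod (A R))\<^sup>2) * (13 / (4 * y) * R)"
        using y R by (simp add: field_simps)
      have A_le: "1 - (cmod (A R))\<^sup>2 \<le> C * (2 * m / ((R - m) * sqrt (R - m)))"
      proof -
        have "h z = h (A R) + of_real R"
        proof -
          have "\<phi> R (A R) = z"
            using backward_orbit_in_petal(2)[OF \<phi> \<Delta> _ z, of R] orbit[of R] R by simp
          then show ?thesis
            using hk[OF AB(1), of R] R by simp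
        qed
        then have hA: "h (A R) - c = (h z - c) - of_real R"
          by simp
        have "1 - (cmod (F (A R)))\<^sup>2 \<le> 2 * m / ((R - m) * sqrt (R - m))"
          unfolding F_def
        proof (rule cayley_csqrt_defect_le)
          show "Re (h (A R) - c) \<le> - (R - m)"
            unfolding hA m_def using complex_Re_le_cmod[of "h z - c"] by simp
          show "\<bar>Im (h (A R) - c)\<bar> \<le> m"
            unfolding hA m_def using abs_Im_le_cmod[of "h z - c"] by simp
        qed (use R Re_csqrt_pos[OF AB(1)] in auto)
        then show ?thesis
          using C(2)[OF AB(1)] C(1) by (meson mult_left_mono less_imp_le order_trans)
      qed
      have "0 \<le> 13 / (4 * y) * R"
        using y R by simp
      then have "?d \<le> C * (2 * m / ((R - m) * sqrt (R - m))) * (13 / (4 * y) * R)"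
        using d_le mult_right_mono[OF A_le] order_trans by blast
      also have "\<dots> = C * (2 * m) * (13 / (4 * y)) / sqrt (R - m) * (R / (R - m))"
        by (simp add: mult_ac)
      also have "\<dots> \<le> C * (2 * m) * (13 / (4 * y)) / sqrt (R - m) * 2"
        using R C m y by (intro mult_left_mono) (auto simp: pos_divide_le_eq)
      also have "\<dots> = D / sqrt (R - m)"
        by (simp add: D_def)
      finally have "?d \<le> D / sqrt (R - m)" .
      moreover have "(cmod (A R - B' R))\<^sup>2 \<le> ?d"
        unfolding norm_one_minus_cnj_mult using q by (simp add: less_imp_le)
      ultimately show ?case
        by linarith
    qed
  qed
  then have "((\<lambda>R. backward_orbit \<phi> \<Delta> z (- R)) \<longlongrightarrow> \<tau>) at_top"
    by (rule Lim_transform_eventually) (use eventually_ge_at_top[of 0] in eventually_elim, use orbit in auto)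
  then show ?thesis
    by (simp add: filterlim_at_bot_mirror)
qed

section \<open>The tangential speed of petals\<close>

theorem theorem5p1:
  fixes \<phi> :: "real \<Rightarrow> complex \<Rightarrow> complex" and \<Delta> :: "complex set"
    and z :: complex and \<eta> :: "real \<Rightarrow> complex"
  assumes "disk_semigroup \<phi>" and "\<not> disk_group \<phi>"
    and "petal \<phi> \<Delta>" and "z \<in> \<Delta>" and "petal_geodesic \<phi> \<Delta> z \<eta>"
  shows "(hyperbolic_petal \<phi> \<Delta> \<longrightarrow>
            Limsup at_bot (\<lambda>t. ereal (tangential_speed \<phi> \<Delta> z \<eta> t)) < \<infinity>) \<and>
         (parabolic_petal \<phi> \<Delta> \<longrightarrow>
            filterlim (tangential_speed \<phi> \<Delta> z \<eta>) at_top at_bot)"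
proof -
  let ?b = "backward_orbit \<phi> \<Delta> z"
  note \<phi> = assms(1) and \<Delta> = assms(3) and z = assms(4)
  obtain p where geo: "full_geodesic \<eta>" "\<eta> 0 = z" "(\<eta> \<longlongrightarrow> p) (at_left 1)"
    and p: "petal_endpoint \<phi> \<Delta> p"
    using assms(5) by (auto simp: petal_geodesic_def)
  have z1: "cmod z < 1"
    using petal_subset_disk[OF \<phi> \<Delta>] z by auto
  have b1: "cmod (?b t) < 1" and \<phi>b: "\<phi> (- t) (?b t) = z" if "t \<le> 0" for t
    using backward_orbit_in_petal[OF \<phi> \<Delta> _ z, of "- t"] petal_subset_disk[OF \<phi> \<Delta>] that by auto
  show ?thesis
  proof (intro conjI impI)
    assume hyp: "hyperbolic_petal \<phi> \<Delta>"
    then have rep: "repelling_fixed_point \<phi> p" and lim: "(?b \<longlongrightarrow> p) at_bot"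
      using p z hyperbolic_not_parabolic[OF \<phi>] by (auto simp: petal_endpoint_def)
    have p1: "cmod p = 1" and notDW: "\<not> Denjoy_Wolff_point \<phi> p"
      using rep by (auto simp: repelling_fixed_point_def regular_fixed_point_def boundary_fixed_point_def)
    obtain \<tau> where \<tau>: "Denjoy_Wolff_point \<phi> \<tau>"
      using hyp by (auto simp: hyperbolic_petal_def elliptic_def non_elliptic_def)
    then have "p \<noteq> \<tau>"
      using notDW by auto
    then obtain K where K: "0 \<le> K" "\<forall>\<^sub>F t in at_bot. cmod (p - ?b t) \<le> K * (1 - (cmod (?b t))\<^sup>2)"
      using hyperbolic_petal_nontangential[OF \<phi> \<Delta> z \<tau> p1 _ lim] by blast
    define M where "M = artanh (sqrt (1 - 1 / (2 * K / (1 - cmod z) + 1)\<^sup>2))"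
    have "\<forall>\<^sub>F t in at_bot. ereal (tangential_speed \<phi> \<Delta> z \<eta> t) \<le> ereal M"
      using K(2) eventually_le_at_bot[of 0]
    proof eventually_elim
      case (elim t)
      show ?case
        unfolding tangential_speed_def M_def ereal_less_eq
        by (rule hyp_dist_curve_le[OF geo z1 p1 b1[OF elim(2)] K(1) elim(1)])
    qed
    then have "Limsup at_bot (\<lambda>t. ereal (tangential_speed \<phi> \<Delta> z \<eta> t)) \<le> ereal M"
      by (rule Limsup_bounded)
    then show "Limsup at_bot (\<lambda>t. ereal (tangential_speed \<phi> \<Delta> z \<eta> t)) < \<infinity>"
      by (auto intro: order_le_less_trans)
  next
    assume par: "parabolic_petal \<phi> \<Delta>"
    then have DW: "Denjoy_Wolff_point \<phi> p"
      using p hyperbolic_not_parabolic[OF \<phi>] by (auto simp: petal_endpoint_def)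
    obtain \<tau> h where \<tau>: "cmod \<tau> = 1" "Denjoy_Wolff_point \<phi> \<tau>"
      and h: "Koenigs_function \<phi> h" "horizontal_half_plane (h ` \<Delta>)"
      using par by (auto simp: parabolic_petal_def non_elliptic_def maximal_subset_def)
    have p1: "cmod p = 1"
      using Denjoy_Wolff_unique[OF DW \<tau>(2)] \<tau>(1) by simp
    have "\<forall>\<^sub>F t in at_bot. cmod (?b t) < 1 \<and> horocycle_level p z \<le> horocycle_level p (?b t)"
      using eventually_le_at_bot[of 0]
    proof eventually_elim
      case (elim t)
      then show ?case
        using Wolff_horocycle[OF \<phi> DW p1, of "- t" "?b t"] b1 \<phi>b by simp
    qed
    then show "filterlim (tangential_speed \<phi> \<Delta> z \<eta>) at_top at_bot"
      unfolding tangential_speed_def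
      by (rule hyp_dist_curve_at_top[OF geo z1 p1 _ parabolic_backward_orbit_tendsto[OF \<phi> \<Delta> z DW p1 h]])
  qed
qed

end
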